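(* Let $\gamma=(\gamma_k)_{k\in\mathbb{Z}}\in\ell_2(\mathbb{Z})$ be non-negative, symmetric (i.e. $\gamma_{-k}=\gamma_k$ for all $k$) and non-increasing on $\mathbb{N}_0$, and assume that there is a constant $b>0$ such that $\gamma_{2n}\ge b\,\gamma_n$ for all $n\in\mathbb{N}_0$. Then $$e_n(H_\gamma,\mathrm{INT})^2\;\asymp\;g_n(H_\gamma,L_2)^2\;\asymp\;\frac1n\sum_{j>n}\gamma_j^2 .$$ In particular, if in addition there are $\beta>1/2$ and $k_0\ge 2$ such that $\gamma_k=k^{-1/2}(\log k)^{-\beta}$ for all $k\ge k_0$, then $$a_n(H_\gamma,L_2)\;\asymp\;n^{-1/2}(\log n)^{-\beta}$$ and $$e_n(H_\gamma,\mathrm{INT})\;\asymp\;g_n(H_\gamma,L_2)\;\asymp\;n^{-1/2}(\log n)^{-\beta+1/2}.$$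
   Context: Put $e_j(x)=e^{2\pi i j x}$ for $j\in\mathbb{Z}$, $x\in\mathbb{R}$. For a non-negative sequence $\gamma=(\gamma_j)_{j\in\mathbb{Z}}\in\ell_2(\mathbb{Z})$, $H_\gamma$ denotes the (complex) Hilbert space of all 1-periodic functions $f(x)=\sum_{j\in\mathbb{Z}}\alpha_j e_j(x)$, $x\in[0,1]$, such that $\alpha_j=0$ whenever $\gamma_j=0$ and $\|f\|_{H_\gamma}^2=\sum_{j:\gamma_j\neq 0}|\alpha_j|^2/\gamma_j^2<\infty$. The series converges absolutely and uniformly, and $H_\gamma$ is a reproducing kernel Hilbert space of continuous functions. $L_2=L_2([0,1])$ with Lebesgue measure and norm $\|\cdot\|_2$, and $\mathrm{INT}(f)=\int_0^1f(x)\,dx$. For $n\in\mathbb{N}_0$: - $a_n(H_\gamma,L_2)=\inf_{A_n}\sup_{\|f\|_{H_\gamma}\le1}\|f-A_n(f)\|_2$, infimum over all $A_n(f)=\sum_{i=1}^nL_i(f)g_i$ with linear functionals $L_i$ on $H_\gamma$ and $g_i\in L_2$; - $g_n(H_\gamma,L_2)=\inf_{S_n}\sup_{\|f\|_{H_\gamma}\le1}\|f-S_n(f)\|_2$, infimum over all $S_n(f)=\sum_{i=1}^nf(x_i)g_i$ with $x_i\in[0,1]$, $g_i\in L_2$; - $e_n(H_\gamma,\mathrm{INT})=\inf_{Q_n}\sup_{\|f\|_{H_\gamma}\le1}|\mathrm{INT}(f)-Q_n(f)|$, infimum over all $Q_n(f)=\sum_{i=1}^nw_if(x_i)$ with $w_i\in\mathbb{C}$,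 $x_i\in[0,1]$. For non-negative sequences, $u_n\asymp v_n$ means that there are constants $c,C>0$ (independent of $n$, possibly depending on $\gamma$) with $c\,v_n\le u_n\le C\,v_n$ for all except finitely many $n$. *)

theory Defs
  imports "HOL-Analysis.Analysis"
begin

definition fourier_exp :: "int \<Rightarrow> real \<Rightarrow> complex" where
  "fourier_exp j x = exp (2 * of_real pi * \<i> * of_int j * of_real x)"

text \<open>Convergence of the Fourier series is unconditional summability over the integers (for complex
  series this is absolute convergence). It is required at every real point, which is the same as
  requiring it on \<open>[0,1]\<close> together with 1-periodicity.\<close>

definition is_fourier_series :: "(int \<Rightarrow> complex) \<Rightarrow> (real \<Rightarrow> complex) \<Rightarrow> bool" where
  "is_fourier_series \<alpha> f \<longleftrightarrow> (\<forall>x. ((\<lambda>j. \<alpha> j * fourier_exp j x) has_sum f x) UNIV)"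

text \<open>The coefficient sequence is unique, so the definite description below is well defined.\<close>

lemma fourier_exp_at_0 [simp]: "fourier_exp j 0 = 1"
  by (simp add: fourier_exp_def)

lemma norm_fourier_exp [simp]: "norm (fourier_exp j x) = 1"
proof -
  have "fourier_exp j x = exp (\<i> * of_real (2 * pi * of_int j * x))"
    by (simp add: fourier_exp_def mult_ac)
  then show ?thesis by (metis norm_exp_i_times)
qed

lemma fourier_exp_mult: "fourier_exp j x * fourier_exp k x = fourier_exp (j + k) x"
  by (simp add: fourier_exp_def exp_add [symmetric] algebra_simps)

lemma fourier_exp_has_integral:
  "(fourier_exp j has_integral (if j = 0 then 1 else 0)) {0..1}"
proof (cases "j = 0")
  case True
  then show ?thesis
    using has_integral_const_real [of "1::complex" 0 1] by (simp add: fourier_exp_def [abs_def])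
next
  case False
  define c where "c = 2 * of_real pi * \<i> * (of_int j :: complex)"
  have c: "c \<noteq> 0" using False by (simp add: c_def)
  have e: "exp c = 1" by (auto simp: exp_eq_1 c_def)
  have "((\<lambda>x. exp (c * of_real x)) has_integral
      (exp (c * of_real 1) / c - exp (c * of_real 0) / c)) {0..1}"
  proof (rule fundamental_theorem_of_calculus)
    fix x :: real
    have "((\<lambda>z. exp (c * z) / c) has_field_derivative exp (c * of_real x)) (at (of_real x))"
      using c by (auto intro!: derivative_eq_intros)
    then show "((\<lambda>x. exp (c * of_real x) / c) has_vector_derivative exp (c * of_real x))
        (at x within {0..1})"
      by (rule has_vector_derivative_real_field)
  qed simp
  moreover have "fourier_exp j = (\<lambda>x. exp (c * of_real x))"
    by (auto simp: fourier_exp_def c_def)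
  ultimately show ?thesis using False e by simp
qed

lemma fourier_series_zero:
  assumes "is_fourier_series \<delta> (\<lambda>x. 0)"
  shows "\<delta> k = 0"
proof (rule ccontr)
  assume "\<delta> k \<noteq> 0"
  then have pos: "norm (\<delta> k) / 2 > 0" by simp
  have "(\<delta> has_sum 0) UNIV"
    using assms by (auto simp: is_fourier_series_def dest: spec [of _ 0])
  then have "\<delta> summable_on UNIV" by (auto simp: summable_on_def)
  then have abs: "(\<lambda>j. norm (\<delta> j)) summable_on UNIV"
    by (simp add: summable_on_iff_abs_summable_on_complex)
  obtain F where F: "finite F" and Fs: "dist (sum (\<lambda>j. norm (\<delta> j)) F) (\<Sum>\<^sub>\<infinity>j. norm (\<delta> j)) \<le> norm (\<delta> k) / 2"
    using infsum_finite_approximation [OF abs pos] by blast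
  define G where "G = insert k F"
  have G: "finite G" "k \<in> G" using F by (auto simp: G_def)
  have split: "(\<Sum>\<^sub>\<infinity>j. norm (\<delta> j)) = (\<Sum>j\<in>A. norm (\<delta> j)) + (\<Sum>\<^sub>\<infinity>j\<in>-A. norm (\<delta> j))"
    if "finite A" for A
    using infsum_Un_disjoint [of "\<lambda>j. norm (\<delta> j)" A "-A"] that
      summable_on_subset_banach [OF abs, of "-A"] by simp
  have "(\<Sum>j\<in>F. norm (\<delta> j)) \<le> (\<Sum>j\<in>G. norm (\<delta> j))"
    by (rule sum_mono2) (use G in \<open>auto simp: G_def\<close>)
  then have tail: "(\<Sum>\<^sub>\<infinity>j\<in>-G. norm (\<delta> j)) \<le> norm (\<delta> k) / 2"
    using Fs split [OF G(1)] unfolding dist_real_def by linarith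
  have bound: "norm (\<Sum>j\<in>G. \<delta> j * fourier_exp (j - k) x) \<le> norm (\<delta> k) / 2" for x
  proof -
    let ?h = "\<lambda>j. \<delta> j * fourier_exp j x"
    have hs: "(?h has_sum 0) UNIV" using assms by (auto simp: is_fourier_series_def)
    have absG: "(\<lambda>j. norm (?h j)) summable_on (-G)"
      using summable_on_subset_banach [OF abs, of "-G"] by (simp add: norm_mult)
    then have sG: "?h summable_on (-G)" by (rule abs_summable_summable)
    have "0 = (\<Sum>j\<in>G. ?h j) + (\<Sum>\<^sub>\<infinity>j\<in>-G. ?h j)"
      using infsum_Un_disjoint [of ?h G "-G"] G(1) sG infsumI [OF hs] by simp
    then have "(\<Sum>j\<in>G. ?h j) = - (\<Sum>\<^sub>\<infinity>j\<in>-G. ?h j)" by (simp add: eq_neg_iff_add_eq_0)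
    then have "norm (\<Sum>j\<in>G. ?h j) = norm (\<Sum>\<^sub>\<infinity>j\<in>-G. ?h j)" by simp
    also have "\<dots> \<le> (\<Sum>\<^sub>\<infinity>j\<in>-G. norm (?h j))" by (rule norm_infsum_bound [OF absG])
    also have "\<dots> \<le> norm (\<delta> k) / 2" using tail by (simp add: norm_mult)
    finally have *: "norm (\<Sum>j\<in>G. ?h j) \<le> norm (\<delta> k) / 2" .
    have "(\<Sum>j\<in>G. \<delta> j * fourier_exp (j - k) x) = (\<Sum>j\<in>G. ?h j) * fourier_exp (- k) x"
      by (simp add: sum_distrib_right fourier_exp_mult mult.assoc)
    then show ?thesis using * by (simp add: norm_mult)
  qed
  have "((\<lambda>x. \<Sum>j\<in>G. \<delta> j * fourier_exp (j - k) x) has_integral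
      (\<Sum>j\<in>G. \<delta> j * (if j - k = 0 then 1 else 0))) {0..1}"
    by (intro has_integral_sum has_integral_mult_right fourier_exp_has_integral G)
  moreover have "(\<Sum>j\<in>G. \<delta> j * (if j - k = 0 then 1 else 0)) = \<delta> k"
    using G by (simp add: if_distrib [of "\<lambda>z. _ * z"] cong: if_cong)
  ultimately have "((\<lambda>x. \<Sum>j\<in>G. \<delta> j * fourier_exp (j - k) x) has_integral \<delta> k) {0..1}"
    by simp
  then have "norm (\<delta> k) \<le> norm (\<delta> k) / 2 * measure lborel {0..1::real}"
    by (rule has_integral_bound_real [OF less_imp_le [OF pos] finite.emptyI]) (rule bound)
  then show False using pos by simp
qed

lemma fourier_series_unique:
  assumes "is_fourier_series \<alpha> f" "is_fourier_series \<beta> f"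
  shows "\<alpha> = \<beta>"
proof
  fix k
  have "is_fourier_series (\<lambda>j. \<alpha> j - \<beta> j) (\<lambda>x. 0)"
    unfolding is_fourier_series_def
  proof
    fix x
    have "((\<lambda>j. \<alpha> j * fourier_exp j x + - (\<beta> j * fourier_exp j x)) has_sum (f x + - f x)) UNIV"
      by (rule has_sum_add) (use assms in \<open>auto simp: is_fourier_series_def has_sum_uminus\<close>)
    then show "((\<lambda>j. (\<alpha> j - \<beta> j) * fourier_exp j x) has_sum 0) UNIV"
      by (simp add: left_diff_distrib)
  qed
  from fourier_series_zero [OF this, of k] show "\<alpha> k = \<beta> k" by simp
qed

definition fourier_coeffs :: "(real \<Rightarrow> complex) \<Rightarrow> int \<Rightarrow> complex" where
  "fourier_coeffs f = (THE \<alpha>. is_fourier_series \<alpha> f)"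

lemma fourier_coeffs_eq: "is_fourier_series \<alpha> f \<Longrightarrow> fourier_coeffs f = \<alpha>"
  unfolding fourier_coeffs_def by (rule the_equality) (auto intro: fourier_series_unique)

definition H_space :: "(int \<Rightarrow> real) \<Rightarrow> (real \<Rightarrow> complex) set" where
  "H_space \<gamma> = {f. \<exists>\<alpha>. is_fourier_series \<alpha> f \<and> (\<forall>j. \<gamma> j = 0 \<longrightarrow> \<alpha> j = 0) \<and>
      (\<lambda>j. (cmod (\<alpha> j))\<^sup>2 / (\<gamma> j)\<^sup>2) summable_on {j. \<gamma> j \<noteq> 0}}"

definition H_norm :: "(int \<Rightarrow> real) \<Rightarrow> (real \<Rightarrow> complex) \<Rightarrow> real" where
  "H_norm \<gamma> f = sqrt (\<Sum>\<^sub>\<infinity>j\<in>{j. \<gamma> j \<noteq> 0}. (cmod (fourier_coeffs f j))\<^sup>2 / (\<gamma> j)\<^sup>2)"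

definition H_ball :: "(int \<Rightarrow> real) \<Rightarrow> (real \<Rightarrow> complex) set" where
  "H_ball \<gamma> = {f \<in> H_space \<gamma>. H_norm \<gamma> f \<le> 1}"

definition H_linear_functional :: "(int \<Rightarrow> real) \<Rightarrow> ((real \<Rightarrow> complex) \<Rightarrow> complex) \<Rightarrow> bool" where
  "H_linear_functional \<gamma> L \<longleftrightarrow>
     (\<forall>f\<in>H_space \<gamma>. \<forall>g\<in>H_space \<gamma>. L (\<lambda>x. f x + g x) = L f + L g) \<and>
     (\<forall>f\<in>H_space \<gamma>. \<forall>c. L (\<lambda>x. c * f x) = c * L f)"

definition L2_space :: "(real \<Rightarrow> complex) set" where
  "L2_space = {g \<in> borel_measurable (lebesgue_on {0..1}).
      integrable (lebesgue_on {0..1}) (\<lambda>x. (cmod (g x))\<^sup>2)}"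

definition L2_norm :: "(real \<Rightarrow> complex) \<Rightarrow> real" where
  "L2_norm f = sqrt (LINT x|lebesgue_on {0..1}. (cmod (f x))\<^sup>2)"

definition int01 :: "(real \<Rightarrow> complex) \<Rightarrow> complex" where
  "int01 f = (LINT x|lebesgue_on {0..1}. f x)"

text \<open>Worst-case errors are taken in the complete lattice of extended non-negative reals, so that an
  algorithm with unbounded error (for instance one using discontinuous functionals) has error
  \<open>\<infinity>\<close>. The \<open>n\<close> functionals, nodes, weights and functions are the values at
  \<open>i < n\<close>.\<close>

definition approx_number :: "nat \<Rightarrow> (int \<Rightarrow> real) \<Rightarrow> ennreal" where
  "approx_number n \<gamma> =
     (INF (L, g) \<in> {(L :: nat \<Rightarrow> (real \<Rightarrow> complex) \<Rightarrow> complex, g :: nat \<Rightarrow> real \<Rightarrow> complex).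
          \<forall>i<n. H_linear_functional \<gamma> (L i) \<and> g i \<in> L2_space}.
      SUP f \<in> H_ball \<gamma>. ennreal (L2_norm (\<lambda>x. f x - (\<Sum>i<n. L i f * g i x))))"

definition sampling_number :: "nat \<Rightarrow> (int \<Rightarrow> real) \<Rightarrow> ennreal" where
  "sampling_number n \<gamma> =
     (INF (t, g) \<in> {(t :: nat \<Rightarrow> real, g :: nat \<Rightarrow> real \<Rightarrow> complex).
          \<forall>i<n. t i \<in> {0..1} \<and> g i \<in> L2_space}.
      SUP f \<in> H_ball \<gamma>. ennreal (L2_norm (\<lambda>x. f x - (\<Sum>i<n. f (t i) * g i x))))"

definition integration_number :: "nat \<Rightarrow> (int \<Rightarrow> real) \<Rightarrow> ennreal" where
  "integration_number n \<gamma> =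
     (INF (t, w) \<in> {(t :: nat \<Rightarrow> real, w :: nat \<Rightarrow> complex). \<forall>i<n. t i \<in> {0..1}}.
      SUP f \<in> H_ball \<gamma>. ennreal (cmod (int01 f - (\<Sum>i<n. w i * f (t i)))))"

definition asymp_equal :: "(nat \<Rightarrow> ennreal) \<Rightarrow> (nat \<Rightarrow> ennreal) \<Rightarrow> bool" (infix "\<asymp>" 50) where
  "u \<asymp> v \<longleftrightarrow> (\<exists>c>0. \<exists>C>0. \<forall>\<^sub>\<infinity>n. ennreal c * v n \<le> u n \<and> u n \<le> ennreal C * v n)"

end

theory Submission
  imports Defs
begin

text \<open>
  Lower bound: a quadrature rule with weights \<open>w i\<close> and nodes \<open>t i\<close> has squared worst-case error
  \<open>\<Sum>j. \<gamma>\<^sub>j\<^sup>2 * |\<delta>\<^sub>j\<^sub>0 - W j|\<^sup>2\<close>, where \<open>W j = (\<Sum>i<n. w i * e\<^sub>j (t i))\<close>. The Toeplitz matrix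
  \<open>(W (a - b))\<close>, \<open>a, b < N\<close>, has rank at most \<open>n\<close>, so its squared trace is at most \<open>n\<close> times its
  squared Frobenius norm. Hence \<open>|W j|\<^sup>2\<close> summed over \<open>0 < |j| < N\<close> is at least
  \<open>N / (2 * n) * |W 0|\<^sup>2\<close> for \<open>N \<ge> 2 * n\<close>. Summation by parts against the decreasing weights
  \<open>\<gamma>\<^sub>j\<^sup>2\<close> bounds the error from below by the tail, because \<open>W 0\<close> and \<open>1 - W 0\<close> cannot both be
  small. Upper bound: trigonometric interpolation at \<open>n\<close> equidistant nodes, where doubling controls
  the aliasing sums \<open>\<Sum>l\<noteq>0. \<gamma>\<^bsub>k + l n\<^esub>\<^sup>2\<close> by the tail divided by \<open>n\<close>.\<close>

section \<open>Traces of matrices of low rank\<close>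

text \<open>Nodes and weights of a rule are arbitrary, so the only rigidity left is the number n of
  exponentials entering W, and the rank of the Toeplitz matrix is the form in which n becomes
  visible. Linear widths cannot replace this argument: for logarithmic weights
  \<open>approx_number\<close> is smaller than the claimed rate by a factor of order
  \<open>sqrt (ln n)\<close>. The rank bound is informative only for windows N \<ge> 2 * n, where
  the central term W 0 can be absorbed; the weighted sum obtained from it therefore starts at 2 * n,
  and doubling brings the start back to n + 1. The two bounds sit at opposite ends of one chain, the
  lower one for integration and the upper one for sampling. They close it because integrating a
  sampling recovery produces a quadrature rule whose error is no larger. The lower bounds use only
  trigonometric polynomials as test functions.\<close>

definition hdot :: "'a set \<Rightarrow> ('a \<Rightarrow> complex) \<Rightarrow> ('a \<Rightarrow> complex) \<Rightarrow> complex" where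
  "hdot A f g = (\<Sum>a\<in>A. f a * cnj (g a))"

lemma hdot_commute: "hdot A g f = cnj (hdot A f g)"
  by (simp add: hdot_def mult.commute)

lemma hdot_diff_left: "hdot A (\<lambda>a. f a - g a) h = hdot A f h - hdot A g h"
  by (simp add: hdot_def algebra_simps sum_subtractf)

lemma hdot_sum_left: "hdot A (\<lambda>a. \<Sum>k\<in>K. c k * u k a) h = (\<Sum>k\<in>K. c k * hdot A (u k) h)"
  unfolding hdot_def sum_distrib_left sum_distrib_right
  by (subst sum.swap) (simp add: mult_ac)

lemma hdot_self: "hdot A f f = of_real (\<Sum>a\<in>A. (cmod (f a))\<^sup>2)"
  by (simp add: hdot_def flip: complex_norm_square)

lemma hdot_eq_0_left: "(\<And>a. a \<in> A \<Longrightarrow> f a = 0) \<Longrightarrow> hdot A f g = 0"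
  by (simp add: hdot_def)

lemma hdot_self_eq_0D:
  assumes "finite A" "hdot A f f = 0" "a \<in> A"
  shows "f a = 0"
proof -
  have "(\<Sum>a\<in>A. (cmod (f a))\<^sup>2) = 0" using assms(2) unfolding hdot_self of_real_eq_0_iff .
  then show ?thesis using assms by (subst (asm) sum_nonneg_eq_0_iff) auto
qed

lemma hdot_cong_left: "(\<And>a. a \<in> A \<Longrightarrow> f a = g a) \<Longrightarrow> hdot A f h = hdot A g h"
  by (simp add: hdot_def)

text \<open>Zero vectors are allowed among the \<open>u k\<close>, so that no rank bookkeeping is needed.\<close>

definition orthonormal_expansion ::
    "'a set \<Rightarrow> nat \<Rightarrow> (nat \<Rightarrow> 'a \<Rightarrow> complex) \<Rightarrow> (nat \<Rightarrow> 'a \<Rightarrow> complex) \<Rightarrow> bool" where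
  "orthonormal_expansion A n v u \<longleftrightarrow>
    (\<forall>k<n. \<forall>l<n. k \<noteq> l \<longrightarrow> hdot A (u k) (u l) = 0) \<and>
    (\<forall>k<n. hdot A (u k) (u k) = 0 \<or> hdot A (u k) (u k) = 1) \<and>
    (\<forall>i<n. \<forall>a\<in>A. v i a = (\<Sum>k<n. hdot A (v i) (u k) * u k a))"

lemma orthonormal_expansionD:
  assumes "orthonormal_expansion A n v u"
  shows "k < n \<Longrightarrow> l < n \<Longrightarrow> k \<noteq> l \<Longrightarrow> hdot A (u k) (u l) = 0"
    and "k < n \<Longrightarrow> hdot A (u k) (u k) = 0 \<or> hdot A (u k) (u k) = 1"
    and "i < n \<Longrightarrow> a \<in> A \<Longrightarrow> v i a = (\<Sum>k<n. hdot A (v i) (u k) * u k a)"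
  using assms unfolding orthonormal_expansion_def by blast+

text \<open>Gram-Schmidt. The induction normalises the residual \<open>r\<close> of the next vector;
  a vanishing residual contributes a zero vector, so the index range stays \<open>n\<close> whatever
  the rank.\<close>

lemma exists_orthonormal_expansion:
  fixes v :: "nat \<Rightarrow> 'a \<Rightarrow> complex"
  assumes A: "finite A"
  shows "\<exists>u. orthonormal_expansion A n v u"
proof (induction n)
  case 0
  show ?case by (simp add: orthonormal_expansion_def)
next
  case (Suc n)
  then obtain u where u: "orthonormal_expansion A n v u"
    by blast
  note u1 = orthonormal_expansionD(1)[OF u] and u2 = orthonormal_expansionD(2)[OF u]
    and u3 = orthonormal_expansionD(3)[OF u]
  define r where "r a = v n a - (\<Sum>k<n. hdot A (v n) (u k) * u k a)" for a
  define \<rho> where "\<rho> = (\<Sum>a\<in>A. (cmod (r a))\<^sup>2)"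
  have \<rho>: "\<rho> \<ge> 0" by (simp add: \<rho>_def sum_nonneg)
  \<comment> \<open>If \<open>\<rho> = 0\<close>, division by zero makes \<open>q\<close> the zero
    vector, so its squared norm is \<open>\<rho> / \<rho>\<close> in both cases, hence 0 or
    1.\<close>
  define q where "q a = r a / of_real (sqrt \<rho>)" for a
  have r0: "hdot A r (u l) = 0" if l: "l < n" for l
  proof -
    have "hdot A r (u l) = hdot A (v n) (u l) - (\<Sum>k<n. hdot A (v n) (u k) * hdot A (u k) (u l))"
      unfolding r_def hdot_diff_left hdot_sum_left ..
    also have "(\<Sum>k<n. hdot A (v n) (u k) * hdot A (u k) (u l))
        = (\<Sum>k<n. if k = l then hdot A (v n) (u l) * hdot A (u l) (u l) else 0)"
      by (rule sum.cong) (use u1 l in auto)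
    also have "\<dots> = hdot A (v n) (u l) * hdot A (u l) (u l)" using l by simp
    \<comment> \<open>A zero vector \<open>u l\<close> has inner product 0 with \<open>v n\<close>,
      so the equation survives the missing normalisation.\<close>
    also have "\<dots> = hdot A (v n) (u l)"
    proof (cases "hdot A (u l) (u l) = 1")
      case False
      then have "hdot A (u l) (u l) = 0" using u2[OF l] by blast
      then have "\<And>a. a \<in> A \<Longrightarrow> u l a = 0" using hdot_self_eq_0D[OF A] by blast
      then have "hdot A (u l) (v n) = 0" by (rule hdot_eq_0_left)
      then have "hdot A (v n) (u l) = 0" by (subst hdot_commute) simp
      then show ?thesis by simp
    qed simp
    finally show ?thesis by simp
  qed
  have q0: "hdot A q (u l) = 0" if l: "l < n" for l
  proof -
    have "hdot A q (u l) = hdot A r (u l) / of_real (sqrt \<rho>)"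
      by (simp add: hdot_def q_def sum_divide_distrib)
    then show ?thesis using r0[OF l] by simp
  qed
  have q0': "hdot A (u l) q = 0" if l: "l < n" for l
    by (subst hdot_commute) (simp add: q0[OF l])
  have qq: "hdot A q q = of_real (\<rho> / \<rho>)"
  proof -
    have "(cmod (q a))\<^sup>2 = (cmod (r a))\<^sup>2 / \<rho>" for a
      using \<rho> by (simp add: q_def norm_divide power_divide)
    then show ?thesis by (simp add: hdot_self \<rho>_def sum_divide_distrib[symmetric])
  qed
  have vr: "hdot A (v n) r = of_real \<rho>"
  proof -
    have "v n = (\<lambda>a. r a - (\<Sum>k<n. - hdot A (v n) (u k) * u k a))"
      by (auto simp: r_def sum_negf)
    then have "hdot A (v n) r = hdot A r r - (\<Sum>k<n. - hdot A (v n) (u k) * hdot A (u k) r)"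
      by (metis hdot_diff_left hdot_sum_left)
    moreover have "hdot A (u k) r = 0" if "k < n" for k
      by (subst hdot_commute) (simp add: r0[OF that])
    ultimately show ?thesis by (simp add: hdot_self \<rho>_def)
  qed
  have vq: "hdot A (v n) q * q a = r a" if a: "a \<in> A" for a
  proof (cases "\<rho> = 0")
    case True
    then have "hdot A r r = 0" by (simp add: hdot_self \<rho>_def)
    then have "r a = 0" by (rule hdot_self_eq_0D[OF A _ a])
    then show ?thesis by (simp add: q_def)
  next
    case False
    have "hdot A (v n) q = hdot A (v n) r / of_real (sqrt \<rho>)"
      by (simp add: hdot_def q_def sum_divide_distrib)
    then have "hdot A (v n) q * q a = of_real \<rho> * r a / (of_real (sqrt \<rho>) * of_real (sqrt \<rho>))"
      by (simp add: vr q_def)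
    also have "complex_of_real (sqrt \<rho>) * of_real (sqrt \<rho>) = of_real \<rho>"
      using \<rho> by (simp flip: of_real_mult)
    finally show ?thesis using False by simp
  qed
  have vq': "hdot A (v i) q = 0" if i: "i < n" for i
  proof -
    have "hdot A (v i) q = hdot A (\<lambda>a. \<Sum>k<n. hdot A (v i) (u k) * u k a) q"
      by (rule hdot_cong_left) (rule u3[OF i])
    also have "\<dots> = 0" unfolding hdot_sum_left by (simp add: q0')
    finally show ?thesis .
  qed
  have "orthonormal_expansion A (Suc n) v (u(n := q))"
    unfolding orthonormal_expansion_def
  proof (intro conjI allI impI ballI)
    fix k l assume "k < Suc n" "l < Suc n" "k \<noteq> l"
    then show "hdot A ((u(n := q)) k) ((u(n := q)) l) = 0"
      by (auto simp: less_Suc_eq u1 q0 q0')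
  next
    fix k assume "k < Suc n"
    then show "hdot A ((u(n := q)) k) ((u(n := q)) k) = 0 \<or> hdot A ((u(n := q)) k) ((u(n := q)) k) = 1"
      using u2 by (auto simp: less_Suc_eq qq)
  next
    fix i a assume i: "i < Suc n" and a: "a \<in> A"
    show "v i a = (\<Sum>k<Suc n. hdot A (v i) ((u(n := q)) k) * (u(n := q)) k a)"
    proof (cases "i = n")
      case True
      then show ?thesis using vq[OF a] by (simp add: r_def)
    next
      case False
      then have "i < n" using i by simp
      then show ?thesis using u3[OF _ a] vq' by simp
    qed
  qed
  then show ?case by blast
qed

text \<open>Let Q be the orthogonal projection onto the span of the \<open>u k\<close>, which
  contains all \<open>v i\<close>. Then M Q = M, so the trace of M is that of M Q, and
  Cauchy-Schwarz for the Frobenius pairing leaves the squared Frobenius norm of Q, which is its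
  rank. The weights are complex, so M is not Hermitian in general and eigenvalues are
  avoided.\<close>

lemma norm_trace_le:
  fixes v :: "nat \<Rightarrow> 'a \<Rightarrow> complex" and w :: "nat \<Rightarrow> complex"
  assumes A: "finite A" and M: "\<And>a b. M a b = (\<Sum>i<n. w i * v i a * cnj (v i b))"
  shows "(cmod (\<Sum>a\<in>A. M a a))\<^sup>2 \<le> real n * (\<Sum>a\<in>A. \<Sum>b\<in>A. (cmod (M a b))\<^sup>2)"
proof -
  obtain u where u: "orthonormal_expansion A n v u"
    using exists_orthonormal_expansion[OF A] by blast
  note u1 = orthonormal_expansionD(1)[OF u] and u2 = orthonormal_expansionD(2)[OF u]
    and u3 = orthonormal_expansionD(3)[OF u]
  \<comment> \<open>The transposed kernel of the projection; transposing turns the trace of a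
    product into an entrywise pairing.\<close>
  define P where "P = (\<lambda>(a, b). \<Sum>k<n. cnj (u k a) * u k b)"
  have vv: "hdot A (v i) (v i) = (\<Sum>k<n. hdot A (v i) (u k) * hdot A (u k) (v i))" if "i < n" for i
  proof -
    have "hdot A (v i) (v i) = hdot A (\<lambda>a. \<Sum>k<n. hdot A (v i) (u k) * u k a) (v i)"
      by (rule hdot_cong_left) (rule u3[OF that])
    then show ?thesis unfolding hdot_sum_left .
  qed
  have pair: "hdot A f g * hdot A f' g' = (\<Sum>(a, b)\<in>A \<times> A. f a * cnj (g a) * (f' b * cnj (g' b)))"
    for f g f' g' :: "'a \<Rightarrow> complex"
    by (simp add: hdot_def sum_product sum.cartesian_product)
  have "(\<Sum>a\<in>A. M a a) = (\<Sum>i<n. w i * hdot A (v i) (v i))"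
    unfolding M hdot_def sum_distrib_left by (subst sum.swap) (simp add: mult_ac)
  also have "\<dots> = (\<Sum>i<n. \<Sum>k<n. \<Sum>(a, b)\<in>A \<times> A. w i * v i a * cnj (v i b) * (cnj (u k a) * u k b))"
  proof (rule sum.cong[OF refl])
    fix i assume "i \<in> {..<n}"
    then show "w i * hdot A (v i) (v i)
        = (\<Sum>k<n. \<Sum>(a, b)\<in>A \<times> A. w i * v i a * cnj (v i b) * (cnj (u k a) * u k b))"
      unfolding vv[OF lessThan_iff[THEN iffD1, OF \<open>i \<in> {..<n}\<close>]] pair sum_distrib_left case_prod_beta
      by (simp only: mult_ac)
  qed
  also have "\<dots> = (\<Sum>z\<in>A \<times> A. (\<Sum>i<n. w i * v i (fst z) * cnj (v i (snd z))) * P z)"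
    by (simp only: P_def sum_product case_prod_beta sum.swap[of _ "A \<times> A"])
  finally have tr: "(\<Sum>a\<in>A. M a a) = (\<Sum>z\<in>A \<times> A. M (fst z) (snd z) * P z)"
    by (simp add: M)
  \<comment> \<open>Orthonormality collapses the double sum, so the squared norm of \<open>P\<close>
    counts the nonzero \<open>u k\<close>.\<close>
  have "of_real (\<Sum>z\<in>A \<times> A. (cmod (P z))\<^sup>2) = (\<Sum>z\<in>A \<times> A. P z * cnj (P z))"
    by (simp flip: complex_norm_square)
  also have "\<dots> = (\<Sum>k<n. \<Sum>l<n. hdot A (u l) (u k) * hdot A (u k) (u l))"
    by (simp only: P_def sum_product case_prod_beta sum.swap[of _ "A \<times> A"] cnj_sum pair
      complex_cnj_mult complex_cnj_cnj mult_ac)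
  also have "\<dots> = (\<Sum>k<n. \<Sum>l<n. if k = l then hdot A (u k) (u k) else 0)"
    by (intro sum.cong refl) (use u1 u2 in fastforce)
  also have "\<dots> = (\<Sum>k<n. hdot A (u k) (u k))" by simp
  also have "\<dots> = of_real (\<Sum>k<n. Re (hdot A (u k) (u k)))"
    by (simp add: hdot_self)
  finally have "(\<Sum>z\<in>A \<times> A. (cmod (P z))\<^sup>2) = (\<Sum>k<n. Re (hdot A (u k) (u k)))"
    unfolding of_real_eq_iff .
  also have "\<dots> \<le> (\<Sum>k<n. 1)"
    by (rule sum_mono) (use u2 in fastforce)
  finally have PP: "(\<Sum>z\<in>A \<times> A. (cmod (P z))\<^sup>2) \<le> real n" by simp
  have "cmod (\<Sum>a\<in>A. M a a) \<le> (\<Sum>z\<in>A \<times> A. cmod (M (fst z) (snd z)) * cmod (P z))"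
    unfolding tr norm_mult[symmetric] by (rule norm_sum)
  then have "(cmod (\<Sum>a\<in>A. M a a))\<^sup>2 \<le> (\<Sum>z\<in>A \<times> A. cmod (M (fst z) (snd z)) * cmod (P z))\<^sup>2"
    by (rule power_mono) simp
  also have "\<dots> \<le> (\<Sum>z\<in>A \<times> A. (cmod (M (fst z) (snd z)))\<^sup>2) * (\<Sum>z\<in>A \<times> A. (cmod (P z))\<^sup>2)"
    by (rule Cauchy_Schwarz_ineq_sum)
  also have "\<dots> \<le> (\<Sum>z\<in>A \<times> A. (cmod (M (fst z) (snd z)))\<^sup>2) * real n"
    by (rule mult_left_mono[OF PP]) (simp add: sum_nonneg)
  also have "(\<Sum>z\<in>A \<times> A. (cmod (M (fst z) (snd z)))\<^sup>2) = (\<Sum>a\<in>A. \<Sum>b\<in>A. (cmod (M a b))\<^sup>2)"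
    by (simp add: sum.cartesian_product case_prod_beta)
  finally show ?thesis by (simp add: mult.commute)
qed

text \<open>The squared lengths of the projections of the coordinate vectors onto the span of the
  \<open>u k\<close> add up to at most \<open>n\<close>, less than the number of these vectors.
  Hence some coordinate vector is shortened by the projection, and the difference is the vector
  sought.\<close>

lemma exists_orthogonal_vector:
  fixes v :: "nat \<Rightarrow> 'a \<Rightarrow> complex"
  assumes A: "finite A" and n: "n < card A"
  obtains x where "\<And>i. i < n \<Longrightarrow> hdot A x (v i) = 0" and "\<exists>a\<in>A. x a \<noteq> 0"
proof -
  obtain u where u: "orthonormal_expansion A n v u"
    using exists_orthonormal_expansion[OF A] by blast
  note u1 = orthonormal_expansionD(1)[OF u] and u2 = orthonormal_expansionD(2)[OF u]
    and u3 = orthonormal_expansionD(3)[OF u]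
  have "(\<Sum>a\<in>A. \<Sum>k<n. (cmod (u k a))\<^sup>2) = (\<Sum>k<n. Re (hdot A (u k) (u k)))"
    by (subst sum.swap) (simp add: hdot_self)
  also have "\<dots> \<le> (\<Sum>k<n. 1)"
    by (rule sum_mono) (use u2 in fastforce)
  also have "\<dots> < (\<Sum>a\<in>A. 1)" using n by simp
  finally obtain c where c: "c \<in> A" "(\<Sum>k<n. (cmod (u k c))\<^sup>2) < 1"
    by (metis (no_types, lifting) not_le sum_mono)
  define x where "x a = (if a = c then 1 else 0) - (\<Sum>k<n. cnj (u k c) * u k a)" for a
  have xu: "hdot A x (u l) = 0" if l: "l < n" for l
  proof -
    have "hdot A x (u l) = hdot A (\<lambda>a. if a = c then 1 else 0) (u l) - (\<Sum>k<n. cnj (u k c) * hdot A (u k) (u l))"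
      unfolding x_def hdot_diff_left hdot_sum_left ..
    also have "hdot A (\<lambda>a. if a = c then 1 else 0) (u l) = cnj (u l c)"
      using A c by (simp add: hdot_def mult_if_delta)
    also have "(\<Sum>k<n. cnj (u k c) * hdot A (u k) (u l))
        = (\<Sum>k<n. if k = l then cnj (u l c) * hdot A (u l) (u l) else 0)"
      by (rule sum.cong) (use u1 l in auto)
    also have "\<dots> = cnj (u l c) * hdot A (u l) (u l)" using l by simp
    also have "\<dots> = cnj (u l c)"
      using u2[OF l] hdot_self_eq_0D[OF A _ c(1)] by fastforce
    finally show ?thesis by simp
  qed
  have "hdot A x (v i) = 0" if i: "i < n" for i
  proof -
    have "hdot A (v i) x = hdot A (\<lambda>a. \<Sum>k<n. hdot A (v i) (u k) * u k a) x"
      by (rule hdot_cong_left) (rule u3[OF i])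
    also have "\<dots> = (\<Sum>k<n. hdot A (v i) (u k) * cnj (hdot A x (u k)))"
      unfolding hdot_sum_left by (simp flip: hdot_commute)
    also have "\<dots> = 0" by (simp add: xu)
    finally show ?thesis by (subst hdot_commute) simp
  qed
  \<comment> \<open>At \<open>c\<close> the difference has the value 1 minus the squared length of
    the projection, which is below 1.\<close>
  moreover have "x c \<noteq> 0"
  proof
    assume "x c = 0"
    then have "(1::complex) = (\<Sum>k<n. u k c * cnj (u k c))" by (simp add: x_def mult.commute)
    also have "\<dots> = of_real (\<Sum>k<n. (cmod (u k c))\<^sup>2)" by (simp flip: complex_norm_square)
    finally have "(\<Sum>k<n. (cmod (u k c))\<^sup>2) = 1" by (metis of_real_eq_1_iff)
    then show False using c by simp
  qed
  ultimately show ?thesis using that c(1) by blast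
qed

section \<open>Fourier series\<close>

lemma fourier_exp_continuous [continuous_intros]: "continuous_on S (fourier_exp j)"
  unfolding fourier_exp_def [abs_def] by (intro continuous_intros)

lemma cnj_fourier_exp: "cnj (fourier_exp j x) = fourier_exp (- j) x"
  by (simp add: fourier_exp_def exp_cnj)

lemma fourier_exp_mult_cnj: "fourier_exp j x * cnj (fourier_exp k x) = fourier_exp (j - k) x"
  by (simp add: cnj_fourier_exp fourier_exp_mult)

lemma fourier_exp_measurable [measurable]: "fourier_exp j \<in> borel_measurable (lebesgue_on {0..1})"
  by (intro continuous_imp_measurable_on_sets_lebesgue continuous_intros) simp

lemma finite_measure_unit: "finite_measure (lebesgue_on {0..1::real})"
  by (rule finite_measure_lebesgue_on) simp

lemma measure_unit: "measure (lebesgue_on {0..1::real}) (space (lebesgue_on {0..1})) = 1"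
  by (simp add: measure_restrict_space)

lemma integrable_bounded_unit:
  fixes f :: "real \<Rightarrow> 'a :: {banach, second_countable_topology}"
  assumes "f \<in> borel_measurable (lebesgue_on {0..1})" "\<And>x. norm (f x) \<le> B"
  shows "integrable (lebesgue_on {0..1}) f"
  by (rule finite_measure.integrable_const_bound[OF finite_measure_unit, of _ B]) (use assms in auto)

lemma fourier_exp_integrable: "integrable (lebesgue_on {0..1}) (fourier_exp j)"
  by (rule integrable_bounded_unit[of _ 1]) auto

lemma integral_fourier_exp:
  "(LINT x|lebesgue_on {0..1}. fourier_exp j x) = (if j = 0 then 1 else 0)"
  using fourier_exp_has_integral[of j] fourier_exp_integrable[of j]
  by (simp add: lebesgue_integral_eq_integral integral_unique)

lemma integral_norm2_trig_poly:
  assumes F: "finite F"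
  shows "(LINT x|lebesgue_on {0..1}. (cmod (\<Sum>j\<in>F. \<alpha> j * fourier_exp j x))\<^sup>2) = (\<Sum>j\<in>F. (cmod (\<alpha> j))\<^sup>2)"
proof -
  have *: "complex_of_real ((cmod (\<Sum>j\<in>F. \<alpha> j * fourier_exp j x))\<^sup>2)
      = (\<Sum>j\<in>F. \<Sum>k\<in>F. \<alpha> j * cnj (\<alpha> k) * fourier_exp (j - k) x)" for x
    unfolding complex_norm_square cnj_sum sum_product
    by (intro sum.cong refl) (simp add: fourier_exp_mult_cnj[symmetric])
  have "complex_of_real (LINT x|lebesgue_on {0..1}. (cmod (\<Sum>j\<in>F. \<alpha> j * fourier_exp j x))\<^sup>2)
      = (LINT x|lebesgue_on {0..1}. (\<Sum>j\<in>F. \<Sum>k\<in>F. \<alpha> j * cnj (\<alpha> k) * fourier_exp (j - k) x))"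
    unfolding integral_complex_of_real[symmetric] * ..
  also have "\<dots> = (\<Sum>j\<in>F. \<Sum>k\<in>F. \<alpha> j * cnj (\<alpha> k) * (if j - k = 0 then 1 else 0))"
    by (simp add: fourier_exp_integrable integral_fourier_exp)
  also have "\<dots> = (\<Sum>j\<in>F. \<alpha> j * cnj (\<alpha> j))"
    using F by (intro sum.cong refl) (simp add: if_distrib cong: if_cong)
  also have "\<dots> = of_real (\<Sum>j\<in>F. (cmod (\<alpha> j))\<^sup>2)"
    by (simp flip: complex_norm_square)
  finally show ?thesis unfolding of_real_eq_iff .
qed

lemma is_fourier_series_summable:
  assumes "is_fourier_series \<alpha> f"
  shows "(\<lambda>j. cmod (\<alpha> j)) summable_on UNIV"
proof -
  have "(\<alpha> has_sum f 0) UNIV"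
    using assms by (auto simp: is_fourier_series_def dest: spec [of _ 0])
  then have "\<alpha> summable_on UNIV" by (auto simp: summable_on_def)
  then show ?thesis by (simp add: summable_on_iff_abs_summable_on_complex)
qed

lemma trig_poly_bound:
  assumes "(\<lambda>j. cmod (\<alpha> j)) summable_on UNIV" "finite F"
  shows "cmod (\<Sum>j\<in>F. \<alpha> j * fourier_exp j x) \<le> (\<Sum>\<^sub>\<infinity>j. cmod (\<alpha> j))"
proof -
  have "cmod (\<Sum>j\<in>F. \<alpha> j * fourier_exp j x) \<le> (\<Sum>j\<in>F. cmod (\<alpha> j))"
    by (rule order_trans[OF norm_sum]) (simp add: norm_mult)
  also have "\<dots> \<le> (\<Sum>\<^sub>\<infinity>j. cmod (\<alpha> j))"
    by (rule finite_sum_le_infsum) (use assms in auto)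
  finally show ?thesis .
qed

text \<open>The bridge from unordered sums over the integers to sequences, the setting of dominated
  convergence and of measurability of pointwise limits.\<close>

lemma filterlim_symmetric_intervals:
  "filterlim (\<lambda>m. {- int m..int m}) (finite_subsets_at_top UNIV) sequentially"
  unfolding filterlim_finite_subsets_at_top
proof (intro allI impI)
  fix X :: "int set" assume X: "finite X \<and> X \<subseteq> UNIV"
  define K where "K = Max (insert 0 (abs ` X))"
  have K: "\<bar>x\<bar> \<le> K" if "x \<in> X" for x
    unfolding K_def using X that by (intro Max_ge) auto
  show "\<forall>\<^sub>F m in sequentially. finite {- int m..int m} \<and> X \<subseteq> {- int m..int m} \<and> {- int m..int m} \<subseteq> UNIV"
    using eventually_ge_at_top[of "nat K"]
  proof eventually_elim
    case (elim m)
    then show ?case using K by (fastforce simp: abs_le_iff)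
  qed
qed

lemma is_fourier_series_tendsto:
  assumes "is_fourier_series \<alpha> f"
  shows "(\<lambda>m. \<Sum>j\<in>{- int m..int m}. \<alpha> j * fourier_exp j x) \<longlonglongrightarrow> f x"
proof -
  have "(sum (\<lambda>j. \<alpha> j * fourier_exp j x) \<longlongrightarrow> f x) (finite_subsets_at_top UNIV)"
    using assms unfolding is_fourier_series_def has_sum_def by blast
  from filterlim_compose[OF this filterlim_symmetric_intervals] show ?thesis .
qed

lemma is_fourier_series_measurable:
  assumes "is_fourier_series \<alpha> f"
  shows "f \<in> borel_measurable (lebesgue_on {0..1})"
  by (rule borel_measurable_LIMSEQ_metric[OF _ is_fourier_series_tendsto[OF assms]]) measurable

lemma is_fourier_series_bound:
  assumes "is_fourier_series \<alpha> f"
  shows "cmod (f x) \<le> (\<Sum>\<^sub>\<infinity>j. cmod (\<alpha> j))"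
proof (rule Lim_bounded)
  show "(\<lambda>m. cmod (\<Sum>j\<in>{- int m..int m}. \<alpha> j * fourier_exp j x)) \<longlonglongrightarrow> cmod (f x)"
    by (intro tendsto_norm is_fourier_series_tendsto assms)
  show "\<forall>m\<ge>0. cmod (\<Sum>j\<in>{- int m..int m}. \<alpha> j * fourier_exp j x) \<le> (\<Sum>\<^sub>\<infinity>j. cmod (\<alpha> j))"
    using trig_poly_bound[OF is_fourier_series_summable[OF assms]] by simp
qed

lemma L2_spaceI_bounded:
  assumes [measurable]: "f \<in> borel_measurable (lebesgue_on {0..1})" and B: "\<And>x. cmod (f x) \<le> B"
  shows "f \<in> L2_space"
  unfolding L2_space_def
proof (intro CollectI conjI integrable_bounded_unit)
  fix x show "norm ((cmod (f x))\<^sup>2) \<le> B\<^sup>2"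
    using B[of x] by (simp add: power_mono)
qed measurable

lemma is_fourier_series_L2:
  assumes "is_fourier_series \<alpha> f"
  shows "f \<in> L2_space"
  using is_fourier_series_measurable[OF assms] is_fourier_series_bound[OF assms] by (rule L2_spaceI_bounded)

text \<open>The partial sums are bounded by the absolute sum of the coefficients, a constant, so
  dominated convergence on the unit interval carries the finite Parseval identity to the
  limit.\<close>

lemma parseval_limit:
  assumes f: "is_fourier_series \<alpha> f"
  shows "(\<lambda>m. \<Sum>j\<in>{- int m..int m}. (cmod (\<alpha> j))\<^sup>2) \<longlonglongrightarrow> (L2_norm f)\<^sup>2"
proof -
  let ?M = "lebesgue_on {0..1::real}" and ?B = "\<Sum>\<^sub>\<infinity>j. cmod (\<alpha> j)"
  have [measurable]: "f \<in> borel_measurable ?M" by (rule is_fourier_series_measurable[OF f])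
  have "(\<lambda>m. LINT x|?M. (cmod (\<Sum>j\<in>{- int m..int m}. \<alpha> j * fourier_exp j x))\<^sup>2)
      \<longlonglongrightarrow> (LINT x|?M. (cmod (f x))\<^sup>2)"
  proof (rule integral_dominated_convergence[where w = "\<lambda>_. ?B\<^sup>2"])
    show "integrable ?M (\<lambda>_. ?B\<^sup>2)" by (rule integrable_bounded_unit[of _ "?B\<^sup>2"]) auto
    show "AE x in ?M. (\<lambda>m. (cmod (\<Sum>j\<in>{- int m..int m}. \<alpha> j * fourier_exp j x))\<^sup>2) \<longlonglongrightarrow> (cmod (f x))\<^sup>2"
      by (intro AE_I2 tendsto_power tendsto_norm is_fourier_series_tendsto f)
    show "AE x in ?M. norm ((cmod (\<Sum>j\<in>{- int m..int m}. \<alpha> j * fourier_exp j x))\<^sup>2) \<le> ?B\<^sup>2" for m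
      using trig_poly_bound[OF is_fourier_series_summable[OF f]] by (intro AE_I2) (simp add: power_mono)
  qed measurable
  then show ?thesis by (simp add: L2_norm_def integral_norm2_trig_poly)
qed

lemma L2_norm_le:
  assumes "is_fourier_series \<alpha> f" "0 \<le> C" "\<And>F. finite F \<Longrightarrow> (\<Sum>j\<in>F. (cmod (\<alpha> j))\<^sup>2) \<le> C\<^sup>2"
  shows "L2_norm f \<le> C"
proof -
  have "(L2_norm f)\<^sup>2 \<le> C\<^sup>2"
    using parseval_limit[OF assms(1)] by (rule Lim_bounded) (use assms(3) in auto)
  then show ?thesis using assms(2) by (rule power2_le_imp_le)
qed

lemma integrable_of_square_integrable:
  assumes "h \<in> L2_space"
  shows "integrable (lebesgue_on {0..1}) h"
proof -
  have "integrable (lebesgue_on {0..1}) (\<lambda>x. 1 + (cmod (h x))\<^sup>2)"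
  proof (rule Bochner_Integration.integrable_add)
    show "integrable (lebesgue_on {0..1::real}) (\<lambda>x. 1::real)"
      by (rule integrable_bounded_unit[of _ 1]) auto
  qed (use assms in \<open>simp add: L2_space_def\<close>)
  then show ?thesis
  proof (rule Bochner_Integration.integrable_bound)
    show "AE x in lebesgue_on {0..1}. cmod (h x) \<le> norm (1 + (cmod (h x))\<^sup>2)"
    proof (intro AE_I2)
      fix x
      have "0 \<le> (cmod (h x) - 1)\<^sup>2" by simp
      then have "2 * cmod (h x) \<le> 1 + (cmod (h x))\<^sup>2" by (simp add: power2_diff)
      then show "cmod (h x) \<le> norm (1 + (cmod (h x))\<^sup>2)"
        using norm_ge_zero[of "h x"] by (simp del: norm_ge_zero)
    qed
  qed (use assms in \<open>simp add: L2_space_def\<close>)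
qed

text \<open>On a probability space the variance of \<open>cmod (h x)\<close> is nonnegative, which
  bounds its mean by the L2 norm.\<close>

lemma norm_int01_le_L2_norm:
  assumes h: "h \<in> L2_space"
  shows "cmod (int01 h) \<le> L2_norm h"
proof -
  let ?M = "lebesgue_on {0..1::real}"
  define m where "m = (LINT x|?M. cmod (h x))"
  have ih: "integrable ?M (\<lambda>x. cmod (h x))" "integrable ?M (\<lambda>x. (cmod (h x))\<^sup>2)"
    using integrable_of_square_integrable[OF h] h by (auto simp: L2_space_def)
  have ic: "integrable ?M (\<lambda>x. c)" for c :: real by (rule integrable_bounded_unit[of _ "\<bar>c\<bar>"]) auto
  have "0 \<le> (LINT x|?M. (cmod (h x) - m)\<^sup>2)" by (rule Bochner_Integration.integral_nonneg) simp
  also have "\<dots> = (LINT x|?M. (cmod (h x))\<^sup>2 + (m\<^sup>2 - 2 * m * cmod (h x)))"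
    by (simp add: power2_diff algebra_simps)
  also have "\<dots> = (LINT x|?M. (cmod (h x))\<^sup>2) + (m\<^sup>2 - 2 * m * m)"
    using ih ic measure_unit by (simp add: m_def)
  finally have "m\<^sup>2 \<le> (LINT x|?M. (cmod (h x))\<^sup>2)" by (simp add: power2_eq_square)
  then have "m \<le> L2_norm h" unfolding L2_norm_def by (rule real_le_rsqrt)
  moreover have "cmod (int01 h) \<le> m" unfolding int01_def m_def by (rule integral_norm_bound)
  ultimately show ?thesis by simp
qed

lemma is_fourier_series_trig_poly:
  assumes "finite F" "\<And>j. j \<notin> F \<Longrightarrow> \<alpha> j = 0"
  shows "is_fourier_series \<alpha> (\<lambda>x. \<Sum>j\<in>F. \<alpha> j * fourier_exp j x)"
  unfolding is_fourier_series_def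
  by (intro allI has_sum_finite_neutralI) (use assms in auto)

lemma is_fourier_series_add:
  assumes "is_fourier_series \<alpha> f" "is_fourier_series \<beta> g"
  shows "is_fourier_series (\<lambda>j. \<alpha> j + \<beta> j) (\<lambda>x. f x + g x)"
  using assms by (auto simp: is_fourier_series_def distrib_right intro: has_sum_add)

lemma is_fourier_series_cmult:
  assumes "is_fourier_series \<alpha> f"
  shows "is_fourier_series (\<lambda>j. c * \<alpha> j) (\<lambda>x. c * f x)"
  using assms by (auto simp: is_fourier_series_def mult.assoc intro: has_sum_cmult_right)

lemma is_fourier_series_diff:
  assumes "is_fourier_series \<alpha> f" "is_fourier_series \<beta> g"
  shows "is_fourier_series (\<lambda>j. \<alpha> j - \<beta> j) (\<lambda>x. f x - g x)"
  using is_fourier_series_add[OF assms(1) is_fourier_series_cmult[OF assms(2), of "-1"]] by simp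

section \<open>Lower bound for integration\<close>

text \<open>The value of the rule at \<open>fourier_exp j\<close>; exactness would mean 1 at
  \<open>j = 0\<close> and 0 elsewhere.\<close>

definition exp_sum :: "nat \<Rightarrow> (nat \<Rightarrow> complex) \<Rightarrow> (nat \<Rightarrow> real) \<Rightarrow> int \<Rightarrow> complex" where
  "exp_sum n w t j = (\<Sum>i<n. w i * fourier_exp j (t i))"

text \<open>The diagonal of the Toeplitz matrix is constant, and each of its \<open>N\<close> rows
  runs through distinct frequencies of the window, so the squared Frobenius norm is at most
  \<open>N\<close> times \<open>?S\<close>. One factor \<open>N\<close> cancels in the trace
  inequality.\<close>

lemma exp_sum_zero_le:
  assumes "N \<ge> 1"
  shows "real N * (cmod (exp_sum n w t 0))\<^sup>2
    \<le> real n * (\<Sum>j\<in>{- int N<..<int N}. (cmod (exp_sum n w t j))\<^sup>2)" (is "_ \<le> real n * ?S")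
proof -
  let ?q = "exp_sum n w t"
  have "(cmod (\<Sum>a<N. ?q (int a - int a)))\<^sup>2 \<le> real n * (\<Sum>a<N. \<Sum>b<N. (cmod (?q (int a - int b)))\<^sup>2)"
  proof (rule norm_trace_le)
    show "?q (int a - int b) = (\<Sum>i<n. w i * fourier_exp (int a) (t i) * cnj (fourier_exp (int b) (t i)))"
      for a b by (simp add: exp_sum_def mult.assoc fourier_exp_mult_cnj)
  qed simp
  also have "\<dots> \<le> real n * (\<Sum>a<N. ?S)"
  proof (intro mult_left_mono sum_mono)
    fix a assume a: "a \<in> {..<N}"
    have "(\<Sum>b<N. (cmod (?q (int a - int b)))\<^sup>2) = (\<Sum>j\<in>(\<lambda>b. int a - int b) ` {..<N}. (cmod (?q j))\<^sup>2)"
      by (subst sum.reindex) (auto simp: inj_on_def)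
    also have "\<dots> \<le> ?S"
      by (rule sum_mono2) (use a in auto)
    finally show "(\<Sum>b<N. (cmod (?q (int a - int b)))\<^sup>2) \<le> ?S" .
  qed simp
  finally have "real N * (real N * (cmod (?q 0))\<^sup>2) \<le> real N * (real n * ?S)"
    by (simp add: norm_mult power_mult_distrib power2_eq_square mult_ac)
  then show ?thesis using assms by simp
qed

lemma sum_symmetric_interval:
  fixes q :: "int \<Rightarrow> real"
  assumes "N \<ge> 1"
  shows "(\<Sum>j\<in>{- int N<..<int N}. q j) = q 0 + (\<Sum>j\<in>{1..<N}. q (int j) + q (- int j))"
  using assms
proof (induction N rule: dec_induct)
  case base
  have "{- int 1<..<int 1} = {0}" by auto
  then show ?case by simp
next
  case (step N)
  have "{- int (Suc N)<..<int (Suc N)} = insert (int N) (insert (- int N) {- int N<..<int N})"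
    using step by auto
  then show ?case using step by simp
qed

text \<open>For \<open>N \<ge> 2 * n\<close> the central term on the right of
  \<open>exp_sum_zero_le\<close> is at most half of the left side. Absorbing it costs the factor 2
  in the denominator.\<close>

lemma exp_sum_dispersion:
  assumes "n \<ge> 1" "N \<ge> 2 * n"
  shows "(cmod (exp_sum n w t 0))\<^sup>2 / (2 * real n) * real N
    \<le> (\<Sum>j\<in>{1..<N}. (cmod (exp_sum n w t (int j)))\<^sup>2 + (cmod (exp_sum n w t (- int j)))\<^sup>2)"
    (is "?z / _ * _ \<le> ?S")
proof -
  have "real N * ?z \<le> real n * (?z + ?S)"
    using exp_sum_zero_le[of N n w t] assms by (simp add: sum_symmetric_interval)
  moreover have "2 * real n * ?z \<le> real N * ?z"
    using assms by (intro mult_right_mono) (simp_all flip: of_nat_mult)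
  ultimately have "real N * ?z \<le> 2 * real n * ?S" by (simp add: algebra_simps)
  then show ?thesis using assms by (simp add: field_simps)
qed

text \<open>Summation by parts in inductive form. The growth assumption on \<open>s\<close> starts
  at \<open>m\<close>, hence so does the sum on the left.\<close>

lemma weighted_sum_ge:
  fixes g s :: "nat \<Rightarrow> real"
  assumes g: "antimono g" "\<And>j. g j \<ge> 0" and s: "\<And>j. s j \<ge> 0"
    and dom: "\<And>N. N \<ge> m \<Longrightarrow> c * real N \<le> (\<Sum>j\<in>{1..<N}. s j)"
    and c: "c \<ge> 0" and m: "m \<ge> 1" and N: "N \<ge> m"
  shows "c * (\<Sum>j\<in>{m..<N}. g j) \<le> (\<Sum>j\<in>{1..<N}. g j * s j)"
proof -
  \<comment> \<open>The induction carries the surplus of the partial sum of \<open>s\<close> over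
    \<open>c * real N\<close>, weighted by \<open>g N\<close>. Passing to \<open>Suc N\<close>
    lowers the weight of a nonnegative surplus, and this is where monotonicity of \<open>g\<close>
    enters.\<close>
  have "c * (\<Sum>j\<in>{m..<N}. g j) + g N * ((\<Sum>j\<in>{1..<N}. s j) - c * real N) \<le> (\<Sum>j\<in>{1..<N}. g j * s j)"
    using N
  proof (induction N rule: dec_induct)
    case base
    have "g m * ((\<Sum>j\<in>{1..<m}. s j) - c * real m) \<le> g m * (\<Sum>j\<in>{1..<m}. s j)"
      using g c by (intro mult_left_mono) auto
    also have "\<dots> \<le> (\<Sum>j\<in>{1..<m}. g j * s j)"
      unfolding sum_distrib_left
      by (intro sum_mono mult_right_mono antimonoD[OF g(1)] s) auto
    finally show ?case by simp
  next
    case (step N)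
    have "g (Suc N) * ((\<Sum>j\<in>{1..<Suc N}. s j) - c * real (Suc N))
        \<le> g N * ((\<Sum>j\<in>{1..<Suc N}. s j) - c * real (Suc N))"
      using dom[of "Suc N"] step by (intro mult_right_mono antimonoD[OF g(1)]) auto
    then show ?case using step m by (simp add: algebra_simps)
  qed
  moreover have "g N * ((\<Sum>j\<in>{1..<N}. s j) - c * real N) \<ge> 0"
    using g dom[OF N] by simp
  ultimately show ?thesis by simp
qed

text \<open>Doubling sends the indices from \<open>Suc n\<close> on to even indices beyond
  \<open>2 * n\<close>, the range in which the dispersion estimate is available.\<close>

lemma sum_doubling:
  fixes g :: "nat \<Rightarrow> real"
  assumes g: "\<And>j. g j \<ge> 0" and d: "\<And>j. g (2 * j) \<ge> b * g j"
  shows "b * (\<Sum>j\<in>{Suc n..<L}. g j) \<le> (\<Sum>j\<in>{2 * n..<2 * L}. g j)"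
proof -
  have "b * (\<Sum>j\<in>{Suc n..<L}. g j) \<le> (\<Sum>j\<in>{Suc n..<L}. g (2 * j))"
    unfolding sum_distrib_left by (rule sum_mono) (rule d)
  also have "\<dots> = (\<Sum>j\<in>(*) 2 ` {Suc n..<L}. g j)"
    by (subst sum.reindex) (auto simp: inj_on_def)
  also have "\<dots> \<le> (\<Sum>j\<in>{2 * n..<2 * L}. g j)"
    by (rule sum_mono2) (use g in auto)
  finally show ?thesis .
qed

lemma int01_trig_poly:
  assumes "finite F"
  shows "int01 (\<lambda>x. \<Sum>j\<in>F. \<alpha> j * fourier_exp j x) = (\<Sum>j\<in>F. \<alpha> j * (if j = 0 then 1 else 0))"
  unfolding int01_def by (simp add: fourier_exp_integrable integral_fourier_exp)

lemma H_norm_eq: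
  assumes "is_fourier_series \<alpha> f"
  shows "H_norm \<gamma> f = sqrt (\<Sum>\<^sub>\<infinity>j\<in>{j. \<gamma> j \<noteq> 0}. (cmod (\<alpha> j))\<^sup>2 / (\<gamma> j)\<^sup>2)"
  unfolding H_norm_def fourier_coeffs_eq[OF assms] ..

lemma trig_poly_in_H_ball:
  assumes F: "finite F" and a0: "\<And>j. j \<notin> F \<Longrightarrow> \<alpha> j = 0" "\<And>j. \<gamma> j = 0 \<Longrightarrow> \<alpha> j = 0"
    and le: "(\<Sum>j\<in>F. (cmod (\<alpha> j))\<^sup>2 / (\<gamma> j)\<^sup>2) \<le> 1"
  shows "(\<lambda>x. \<Sum>j\<in>F. \<alpha> j * fourier_exp j x) \<in> H_ball \<gamma>"
proof -
  let ?f = "\<lambda>x. \<Sum>j\<in>F. \<alpha> j * fourier_exp j x"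
  have s: "is_fourier_series \<alpha> ?f" by (rule is_fourier_series_trig_poly[OF F a0(1)])
  have "((\<lambda>j. (cmod (\<alpha> j))\<^sup>2 / (\<gamma> j)\<^sup>2) has_sum (\<Sum>j\<in>F. (cmod (\<alpha> j))\<^sup>2 / (\<gamma> j)\<^sup>2)) {j. \<gamma> j \<noteq> 0}"
  proof (rule has_sum_finite_neutralI)
    show "(\<Sum>j\<in>F. (cmod (\<alpha> j))\<^sup>2 / (\<gamma> j)\<^sup>2)
        = (\<Sum>j\<in>F \<inter> {j. \<gamma> j \<noteq> 0}. (cmod (\<alpha> j))\<^sup>2 / (\<gamma> j)\<^sup>2)"
      by (rule sum.mono_neutral_right) (use F in auto)
  qed (use F a0 in auto)
  then show ?thesis
    using s a0 le
    by (auto simp: H_ball_def H_space_def H_norm_eq[OF s] infsumI has_sum_imp_summable)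
qed

text \<open>The extremal function of the functional with coefficients \<open>c\<close> has coefficients proportional
  to \<open>\<gamma>\<^sup>2 * cnj c\<close>.\<close>

lemma integration_error_ge:
  fixes n :: nat and w :: "nat \<Rightarrow> complex" and t :: "nat \<Rightarrow> real"
  assumes F: "finite F"
  defines "c \<equiv> \<lambda>j. (if j = 0 then 1 else 0) - exp_sum n w t j"
  shows "ennreal (sqrt (\<Sum>j\<in>F. (\<gamma> j)\<^sup>2 * (cmod (c j))\<^sup>2))
    \<le> (SUP f \<in> H_ball \<gamma>. ennreal (cmod (int01 f - (\<Sum>i<n. w i * f (t i)))))"
proof -
  define S where "S = (\<Sum>j\<in>F. (\<gamma> j)\<^sup>2 * (cmod (c j))\<^sup>2)"
  have S: "S \<ge> 0" by (simp add: S_def sum_nonneg)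
  \<comment> \<open>For \<open>S = 0\<close> the division yields the zero function, whose error 0 is
    again \<open>sqrt S\<close>.\<close>
  define \<alpha> where "\<alpha> j = (if j \<in> F then of_real ((\<gamma> j)\<^sup>2 / sqrt S) * cnj (c j) else 0)" for j
  define f where "f x = (\<Sum>j\<in>F. \<alpha> j * fourier_exp j x)" for x
  have "f \<in> H_ball \<gamma>"
    unfolding f_def
  proof (rule trig_poly_in_H_ball[OF F])
    have "(cmod (\<alpha> j))\<^sup>2 / (\<gamma> j)\<^sup>2 = (\<gamma> j)\<^sup>2 * (cmod (c j))\<^sup>2 / S" if "j \<in> F" for j
      using that S by (cases "\<gamma> j = 0")
        (simp_all add: \<alpha>_def norm_mult norm_divide norm_power power_mult_distrib power_divide power2_eq_square)
    then have "(\<Sum>j\<in>F. (cmod (\<alpha> j))\<^sup>2 / (\<gamma> j)\<^sup>2) = (\<Sum>j\<in>F. (\<gamma> j)\<^sup>2 * (cmod (c j))\<^sup>2 / S)"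
      by (rule sum.cong[OF refl])
    also have "\<dots> = S / S" by (simp only: S_def sum_divide_distrib)
    finally show "(\<Sum>j\<in>F. (cmod (\<alpha> j))\<^sup>2 / (\<gamma> j)\<^sup>2) \<le> 1" by simp
  qed (auto simp: \<alpha>_def)
  moreover have "cmod (int01 f - (\<Sum>i<n. w i * f (t i))) = sqrt S"
  proof -
    have "(\<Sum>i<n. w i * f (t i)) = (\<Sum>j\<in>F. \<alpha> j * exp_sum n w t j)"
      unfolding f_def exp_sum_def sum_distrib_left by (subst sum.swap) (simp add: mult_ac)
    then have "int01 f - (\<Sum>i<n. w i * f (t i)) = (\<Sum>j\<in>F. \<alpha> j * c j)"
      using int01_trig_poly[OF F, of \<alpha>]
      by (simp add: f_def[abs_def] c_def right_diff_distrib sum_subtractf)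
    also have "\<dots> = (\<Sum>j\<in>F. of_real ((\<gamma> j)\<^sup>2 * (cmod (c j))\<^sup>2 / sqrt S))"
      by (intro sum.cong refl) (simp add: \<alpha>_def complex_norm_square mult_ac flip: of_real_power)
    also have "\<dots> = of_real (S / sqrt S)"
      by (simp only: S_def sum_divide_distrib of_real_sum)
    finally show ?thesis using S by (simp add: real_div_sqrt)
  qed
  ultimately show ?thesis
    unfolding S_def[symmetric] by (intro SUP_upper2[of f]) auto
qed


section \<open>Tails of doubling weights and the quadratic form of the error\<close>

locale doubling_weights =
  fixes \<gamma> :: "int \<Rightarrow> real" and b :: real
  assumes nonneg: "\<And>j. \<gamma> j \<ge> 0"
    and square_summable: "(\<lambda>j. (\<gamma> j)\<^sup>2) summable_on UNIV"
    and symmetric: "\<And>k. \<gamma> (- k) = \<gamma> k"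
    and decreasing: "antimono (\<lambda>n::nat. \<gamma> (int n))"
    and b_pos: "b > 0"
    and doubling: "\<And>n::nat. \<gamma> (2 * int n) \<ge> b * \<gamma> (int n)"
begin

definition tail :: "nat \<Rightarrow> real" where
  "tail n = (\<Sum>\<^sub>\<infinity>j\<in>{int n<..}. (\<gamma> j)\<^sup>2)"

lemma tail_sums: "(\<lambda>i. (\<gamma> (int (Suc n + i)))\<^sup>2) sums tail n"
proof -
  have "((\<lambda>j. (\<gamma> j)\<^sup>2) has_sum tail n) {int n<..}"
    unfolding tail_def using square_summable by (intro has_sum_infsum) (rule summable_on_subset_banach, auto)
  moreover have bij: "bij_betw (\<lambda>i. int (Suc n + i)) UNIV {int n<..}"
    by (rule bij_betwI[where g = "\<lambda>j. nat (j - int (Suc n))"]) auto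
  ultimately have "((\<lambda>i. (\<gamma> (int (Suc n + i)))\<^sup>2) has_sum tail n) UNIV"
    using has_sum_reindex_bij_betw[OF bij, of "\<lambda>j. (\<gamma> j)\<^sup>2"] by blast
  then show ?thesis by (rule has_sum_imp_sums)
qed

lemma partial_tail: "(\<Sum>i<m. (\<gamma> (int (Suc n + i)))\<^sup>2) = (\<Sum>j\<in>{Suc n..<Suc n + m}. (\<gamma> (int j))\<^sup>2)"
  using sum.shift_bounds_nat_ivl[of "\<lambda>j. (\<gamma> (int j))\<^sup>2" 0 "Suc n" m]
  by (simp add: atLeast0LessThan add.commute)

lemma tail_nonneg: "0 \<le> tail n"
  unfolding tail_def by (rule infsum_nonneg) simp

lemma partial_tail_le: "(\<Sum>j\<in>{Suc n..<L}. (\<gamma> (int j))\<^sup>2) \<le> tail n"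
proof (cases "Suc n \<le> L")
  case True
  then obtain m where m: "L = Suc n + m" using le_Suc_ex by blast
  show ?thesis
    unfolding m partial_tail[symmetric]
    using sum_le_suminf[OF sums_summable[OF tail_sums], of "{..<m}" n] sums_unique[OF tail_sums, of n] by simp
qed (use tail_nonneg in simp)

lemma tail_le_tail_0: "tail n \<le> tail 0"
proof -
  have "summable (\<lambda>i. (\<gamma> (int (Suc 0 + i)))\<^sup>2)" by (rule sums_summable[OF tail_sums])
  then show ?thesis
    unfolding sums_unique[OF tail_sums, of n] sums_unique[OF tail_sums, of 0]
    by (intro suminf_le power_mono antimonoD[OF decreasing] nonneg sums_summable[OF tail_sums]) auto
qed

text \<open>Test functions have finitely many frequencies and see only a finite part of the tail;
  half of it is enough. A zero tail is treated apart because the limit argument needs a strict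
  inequality.\<close>

lemma exists_half_tail: "\<exists>L > n. tail n / 2 \<le> (\<Sum>j\<in>{Suc n..<L}. (\<gamma> (int j))\<^sup>2)"
proof (cases "tail n = 0")
  case True
  then show ?thesis by (intro exI[of _ "Suc n"]) simp
next
  case False
  then have "tail n / 2 < tail n" using tail_nonneg[of n] by simp
  moreover have "(\<lambda>m. \<Sum>i<m. (\<gamma> (int (Suc n + i)))\<^sup>2) \<longlonglongrightarrow> tail n"
    using tail_sums unfolding sums_def .
  ultimately have "\<forall>\<^sub>F m in sequentially. tail n / 2 < (\<Sum>i<m. (\<gamma> (int (Suc n + i)))\<^sup>2)"
    using order_tendstoD(1) by blast
  then obtain m where "tail n / 2 < (\<Sum>i<m. (\<gamma> (int (Suc n + i)))\<^sup>2)"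
    by (auto simp: eventually_sequentially)
  then show ?thesis unfolding partial_tail by (intro exI[of _ "Suc n + m"]) auto
qed

lemma decreasing_square: "antimono (\<lambda>n::nat. (\<gamma> (int n))\<^sup>2)"
  using decreasing nonneg by (auto simp: antimono_def power_mono)

lemma doubling_square: "(\<gamma> (int (2 * n)))\<^sup>2 \<ge> b\<^sup>2 * (\<gamma> (int n))\<^sup>2"
  using power_mono[OF doubling[of n], of 2] b_pos nonneg by (simp add: power_mult_distrib)

text \<open>Frequency 0 gives the first term. The pairs \<open>j\<close>, \<open>- j\<close> satisfy
  the growth assumption of \<open>weighted_sum_ge\<close> from \<open>2 * n\<close> on with slope
  \<open>?c\<close>, which produces a sum of weights from \<open>2 * n\<close> up to
  \<open>2 * L\<close>; \<open>sum_doubling\<close> trades it for the one from \<open>Suc n\<close>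
  up to \<open>L\<close>.\<close>

lemma quadratic_form_ge:
  fixes w :: "nat \<Rightarrow> complex" and t :: "nat \<Rightarrow> real"
  assumes n: "n \<ge> 1" and L: "L > n"
  defines "z \<equiv> exp_sum n w t 0"
  shows "(\<gamma> 0)\<^sup>2 * (cmod (1 - z))\<^sup>2
      + (cmod z)\<^sup>2 * (b\<^sup>2 / (2 * real n) * (\<Sum>j\<in>{Suc n..<L}. (\<gamma> (int j))\<^sup>2))
    \<le> (\<Sum>j\<in>{- int (2 * L)<..<int (2 * L)}.
        (\<gamma> j)\<^sup>2 * (cmod ((if j = 0 then 1 else 0) - exp_sum n w t j))\<^sup>2)"
proof -
  define s where "s j = (cmod (exp_sum n w t (int j)))\<^sup>2 + (cmod (exp_sum n w t (- int j)))\<^sup>2" for j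
  let ?c = "(cmod z)\<^sup>2 / (2 * real n)"
  have "(cmod z)\<^sup>2 * (b\<^sup>2 / (2 * real n) * (\<Sum>j\<in>{Suc n..<L}. (\<gamma> (int j))\<^sup>2))
      = ?c * (b\<^sup>2 * (\<Sum>j\<in>{Suc n..<L}. (\<gamma> (int j))\<^sup>2))"
    by simp
  also have "\<dots> \<le> ?c * (\<Sum>j\<in>{2 * n..<2 * L}. (\<gamma> (int j))\<^sup>2)"
    by (intro mult_left_mono sum_doubling doubling_square) auto
  also have "\<dots> \<le> (\<Sum>j\<in>{1..<2 * L}. (\<gamma> (int j))\<^sup>2 * s j)"
    by (rule weighted_sum_ge[OF decreasing_square])
      (use n L exp_sum_dispersion[OF n, of _ w t] in \<open>auto simp: s_def z_def\<close>)
  also have "\<dots> = (\<Sum>j\<in>{1..<2 * L}.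
      (\<gamma> (int j))\<^sup>2 * (cmod ((if int j = 0 then 1 else 0) - exp_sum n w t (int j)))\<^sup>2
      + (\<gamma> (- int j))\<^sup>2 * (cmod ((if - int j = 0 then 1 else 0) - exp_sum n w t (- int j)))\<^sup>2)"
    by (rule sum.cong) (auto simp: s_def symmetric distrib_left)
  finally show ?thesis
    using L by (subst sum_symmetric_interval) (auto simp: z_def)
qed

text \<open>A rule pays for \<open>cmod (1 - ?z)\<close> at frequency 0 and for
  \<open>cmod ?z\<close> at the other frequencies. The assumption \<open>le\<close> makes the first
  price at least as high as the second, so the lower price may be charged for both, and the unknown
  \<open>?z\<close> drops out.\<close>

lemma integration_number_ge:
  assumes n: "n \<ge> 1" and le: "b\<^sup>2 * tail n / (2 * real n) \<le> (\<gamma> 0)\<^sup>2"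
  shows "ennreal (sqrt (b\<^sup>2 / 8 * (tail n / real n))) \<le> integration_number n \<gamma>"
  unfolding integration_number_def
proof (intro INF_greatest, clarify)
  fix t :: "nat \<Rightarrow> real" and w :: "nat \<Rightarrow> complex"
  obtain L where L: "L > n" "tail n / 2 \<le> (\<Sum>j\<in>{Suc n..<L}. (\<gamma> (int j))\<^sup>2)"
    using exists_half_tail by blast
  let ?z = "exp_sum n w t 0" and ?S = "\<Sum>j\<in>{Suc n..<L}. (\<gamma> (int j))\<^sup>2"
  define B where "B = b\<^sup>2 / (2 * real n) * ?S"
  have B: "0 \<le> B" unfolding B_def by (intro mult_nonneg_nonneg sum_nonneg) auto
  have "B \<le> b\<^sup>2 / (2 * real n) * tail n"
    unfolding B_def by (intro mult_left_mono partial_tail_le) auto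
  then have B_le: "B \<le> (\<gamma> 0)\<^sup>2" using le by simp
  have "1 \<le> cmod (1 - ?z) + cmod ?z" using norm_triangle_ineq[of "1 - ?z" ?z] by simp
  then have "1 \<le> (cmod (1 - ?z) + cmod ?z)\<^sup>2" by simp
  also have "\<dots> \<le> 2 * ((cmod (1 - ?z))\<^sup>2 + (cmod ?z)\<^sup>2)"
    using zero_le_power2[of "cmod (1 - ?z) - cmod ?z"] by (simp add: power2_diff power2_sum)
  finally have "B * (1 / 2) \<le> B * ((cmod (1 - ?z))\<^sup>2 + (cmod ?z)\<^sup>2)"
    using B by (intro mult_left_mono) auto
  also have "\<dots> \<le> (\<gamma> 0)\<^sup>2 * (cmod (1 - ?z))\<^sup>2 + (cmod ?z)\<^sup>2 * B"
    using mult_right_mono[OF B_le, of "(cmod (1 - ?z))\<^sup>2"] by (simp add: algebra_simps)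
  finally have 1: "B / 2 \<le> (\<gamma> 0)\<^sup>2 * (cmod (1 - ?z))\<^sup>2 + (cmod ?z)\<^sup>2 * B" by simp
  \<comment> \<open>The 8 collects three factors 2: one from dispersion, one from keeping half of
    the tail, one from the lower bound 1/2 for the sum of the two squares.\<close>
  have "b\<^sup>2 / 8 * (tail n / real n) = b\<^sup>2 / (2 * real n) * (tail n / 2) / 2" by simp
  also have "\<dots> \<le> B / 2"
    unfolding B_def using L(2) by (intro divide_right_mono mult_left_mono) auto
  also note 1
  also note quadratic_form_ge[OF n L(1), of w t, folded B_def]
  finally have "ennreal (sqrt (b\<^sup>2 / 8 * (tail n / real n)))
    \<le> ennreal (sqrt (\<Sum>j\<in>{- int (2 * L)<..<int (2 * L)}.
        (\<gamma> j)\<^sup>2 * (cmod ((if j = 0 then 1 else 0) - exp_sum n w t j))\<^sup>2))"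
    by (intro ennreal_leI real_sqrt_le_mono)
  also have "\<dots> \<le> (SUP f \<in> H_ball \<gamma>. ennreal (cmod (int01 f - (\<Sum>i<n. w i * f (t i)))))"
    by (rule integration_error_ge) simp
  finally show "ennreal (sqrt (b\<^sup>2 / 8 * (tail n / real n)))
    \<le> (SUP f \<in> H_ball \<gamma>. ennreal (cmod (int01 f - (\<Sum>i<n. w i * f (t i)))))" .
qed

lemma gamma_abs: "\<gamma> j = \<gamma> (int (nat \<bar>j\<bar>))"
  using symmetric[of j] by (cases "j \<ge> 0") auto

lemma gamma_zero_eq_0: "\<gamma> 0 = 0 \<Longrightarrow> \<gamma> j = 0"
proof -
  assume 0: "\<gamma> 0 = 0"
  have "\<gamma> j = \<gamma> (int (nat \<bar>j\<bar>))" by (rule gamma_abs)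
  also have "\<dots> \<le> \<gamma> (int 0)" by (rule antimonoD[OF decreasing]) simp
  finally show ?thesis using 0 nonneg[of j] by simp
qed

text \<open>The tail is bounded by \<open>tail 0\<close> while \<open>n\<close> grows, so the
  condition of \<open>integration_number_ge\<close> holds eventually if
  \<open>\<gamma> 0 > 0\<close>. If \<open>\<gamma> 0 = 0\<close>, monotonicity and symmetry make
  all weights vanish, and the bound is 0.\<close>

lemma eventually_integration_number_ge:
  "\<forall>\<^sub>F n in sequentially. ennreal (sqrt (b\<^sup>2 / 8) * sqrt (tail n / real n)) \<le> integration_number n \<gamma>"
proof (cases "\<gamma> 0 = 0")
  case True
  then have "tail n = 0" for n unfolding tail_def by (simp add: gamma_zero_eq_0)
  then show ?thesis by simp
next
  case False
  then have pos: "(\<gamma> 0)\<^sup>2 > 0" by simp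
  show ?thesis
    using eventually_ge_at_top[of "nat \<lceil>b\<^sup>2 * tail 0 / (2 * (\<gamma> 0)\<^sup>2)\<rceil>"] eventually_ge_at_top[of 1]
  proof eventually_elim
    case (elim n)
    have "b\<^sup>2 * tail 0 / (2 * (\<gamma> 0)\<^sup>2) \<le> real n" using elim(1) by linarith
    then have "b\<^sup>2 * tail 0 / (2 * real n) \<le> (\<gamma> 0)\<^sup>2" using pos elim(2) by (simp add: field_simps)
    moreover have "b\<^sup>2 * tail n / (2 * real n) \<le> b\<^sup>2 * tail 0 / (2 * real n)"
      by (intro divide_right_mono mult_left_mono tail_le_tail_0) auto
    ultimately show ?case
      unfolding real_sqrt_mult[symmetric] by (intro integration_number_ge elim(2)) linarith
  qed
qed

end

section \<open>Upper bound for sampling recovery\<close>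

lemma L2_space_add:
  assumes f: "f \<in> L2_space" and g: "g \<in> L2_space"
  shows "(\<lambda>x. f x + g x) \<in> L2_space"
  unfolding L2_space_def
proof (intro CollectI conjI)
  have [measurable]: "f \<in> borel_measurable (lebesgue_on {0..1})" "g \<in> borel_measurable (lebesgue_on {0..1})"
    using f g by (auto simp: L2_space_def)
  show "(\<lambda>x. f x + g x) \<in> borel_measurable (lebesgue_on {0..1})" by measurable
  have "integrable (lebesgue_on {0..1}) (\<lambda>x. 2 * (cmod (f x))\<^sup>2 + 2 * (cmod (g x))\<^sup>2)"
    using f g by (intro Bochner_Integration.integrable_add integrable_mult_right) (auto simp: L2_space_def)
  then show "integrable (lebesgue_on {0..1}) (\<lambda>x. (cmod (f x + g x))\<^sup>2)"
  proof (rule Bochner_Integration.integrable_bound)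
    show "AE x in lebesgue_on {0..1}. norm ((cmod (f x + g x))\<^sup>2) \<le> norm (2 * (cmod (f x))\<^sup>2 + 2 * (cmod (g x))\<^sup>2)"
    proof (intro AE_I2)
      fix x
      have "(cmod (f x + g x))\<^sup>2 \<le> (cmod (f x) + cmod (g x))\<^sup>2"
        by (intro power_mono norm_triangle_ineq) simp
      also have "\<dots> \<le> 2 * (cmod (f x))\<^sup>2 + 2 * (cmod (g x))\<^sup>2"
        using zero_le_power2[of "cmod (f x) - cmod (g x)"] by (simp add: power2_diff power2_sum)
      finally show "norm ((cmod (f x + g x))\<^sup>2) \<le> norm (2 * (cmod (f x))\<^sup>2 + 2 * (cmod (g x))\<^sup>2)"
        by simp
    qed
  qed measurable
qed

lemma L2_space_cmult: "f \<in> L2_space \<Longrightarrow> (\<lambda>x. c * f x) \<in> L2_space"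
  by (auto simp: L2_space_def norm_mult power_mult_distrib)

lemma L2_space_zero: "(\<lambda>x. 0) \<in> L2_space"
  by (auto simp: L2_space_def)

lemma L2_space_sum: "finite K \<Longrightarrow> (\<And>i. i \<in> K \<Longrightarrow> g i \<in> L2_space) \<Longrightarrow> (\<lambda>x. \<Sum>i\<in>K. c i * g i x) \<in> L2_space"
  by (induction K rule: finite_induct)
    (simp_all add: L2_space_zero L2_space_add[OF L2_space_cmult])

text \<open>Integrating a recovery formula gives a quadrature rule with the same nodes. Its error is
  the integral of the recovery error, which the L2 norm dominates.\<close>

lemma integration_number_le_sampling_number: "integration_number n \<gamma> \<le> sampling_number n \<gamma>"
  unfolding sampling_number_def
proof (intro INF_greatest, clarify)
  fix t :: "nat \<Rightarrow> real" and g :: "nat \<Rightarrow> real \<Rightarrow> complex"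
  assume tg: "\<forall>i<n. t i \<in> {0..1} \<and> g i \<in> L2_space"
  have "integration_number n \<gamma>
      \<le> (SUP f \<in> H_ball \<gamma>. ennreal (cmod (int01 f - (\<Sum>i<n. int01 (g i) * f (t i)))))"
    unfolding integration_number_def by (rule INF_lower2[of "(t, \<lambda>i. int01 (g i))"]) (use tg in auto)
  also have "\<dots> \<le> (SUP f \<in> H_ball \<gamma>. ennreal (L2_norm (\<lambda>x. f x - (\<Sum>i<n. f (t i) * g i x))))"
  proof (rule SUP_mono)
    fix f assume fH: "f \<in> H_ball \<gamma>"
    then obtain \<alpha> where "is_fourier_series \<alpha> f"
      by (auto simp: H_ball_def H_space_def)
    then have f: "f \<in> L2_space" by (rule is_fourier_series_L2)
    have s: "(\<lambda>x. \<Sum>i<n. - f (t i) * g i x) \<in> L2_space" using tg by (intro L2_space_sum) auto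
    have "int01 (\<lambda>x. f x - (\<Sum>i<n. f (t i) * g i x)) = int01 f - (\<Sum>i<n. int01 (g i) * f (t i))"
    proof -
      have g: "integrable (lebesgue_on {0..1}) (g i)" if "i < n" for i
        using tg that by (simp add: integrable_of_square_integrable)
      have "(LINT x|lebesgue_on {0..1}. (\<Sum>i<n. f (t i) * g i x)) = (\<Sum>i<n. int01 (g i) * f (t i))"
        by (subst Bochner_Integration.integral_sum)
          (use g in \<open>auto intro!: integrable_mult_right sum.cong simp: int01_def\<close>)
      moreover have "integrable (lebesgue_on {0..1}) (\<lambda>x. \<Sum>i<n. f (t i) * g i x)"
        using g by (intro Bochner_Integration.integrable_sum integrable_mult_right) auto
      ultimately show ?thesis
        using integrable_of_square_integrable[OF f] by (simp add: int01_def)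
    qed
    moreover have "(\<lambda>x. f x - (\<Sum>i<n. f (t i) * g i x)) \<in> L2_space"
      using L2_space_add[OF f s] by (simp add: sum_negf)
    ultimately have "cmod (int01 f - (\<Sum>i<n. int01 (g i) * f (t i)))
        \<le> L2_norm (\<lambda>x. f x - (\<Sum>i<n. f (t i) * g i x))"
      using norm_int01_le_L2_norm by metis
    then show "\<exists>h\<in>H_ball \<gamma>. ennreal (cmod (int01 f - (\<Sum>i<n. int01 (g i) * f (t i))))
        \<le> ennreal (L2_norm (\<lambda>x. h x - (\<Sum>i<n. h (t i) * g i x)))"
      using fH by (intro bexI[of _ f] ennreal_leI)
  qed
  finally show "integration_number n \<gamma>
    \<le> (SUP f \<in> H_ball \<gamma>. ennreal (L2_norm (\<lambda>x. f x - (\<Sum>i<n. f (t i) * g i x))))" .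
qed

text \<open>The bound is given for arbitrary finite index sets because it will be applied to unions
  of residue classes; indices with \<open>\<gamma> j = 0\<close> contribute 0, the value of a
  division by zero.\<close>

lemma H_ball_coefficients:
  assumes "f \<in> H_ball \<gamma>"
  obtains \<alpha> where "is_fourier_series \<alpha> f" "\<And>j. \<gamma> j = 0 \<Longrightarrow> \<alpha> j = 0"
    "\<And>F. finite F \<Longrightarrow> (\<Sum>j\<in>F. (cmod (\<alpha> j))\<^sup>2 / (\<gamma> j)\<^sup>2) \<le> 1"
proof -
  obtain \<alpha> where \<alpha>: "is_fourier_series \<alpha> f" "\<And>j. \<gamma> j = 0 \<Longrightarrow> \<alpha> j = 0"
    "(\<lambda>j. (cmod (\<alpha> j))\<^sup>2 / (\<gamma> j)\<^sup>2) summable_on {j. \<gamma> j \<noteq> 0}"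
    using assms by (auto simp: H_ball_def H_space_def)
  have "sqrt (\<Sum>\<^sub>\<infinity>j\<in>{j. \<gamma> j \<noteq> 0}. (cmod (\<alpha> j))\<^sup>2 / (\<gamma> j)\<^sup>2) \<le> 1"
    using assms H_norm_eq[OF \<alpha>(1), of \<gamma>] by (simp add: H_ball_def)
  then have le: "(\<Sum>\<^sub>\<infinity>j\<in>{j. \<gamma> j \<noteq> 0}. (cmod (\<alpha> j))\<^sup>2 / (\<gamma> j)\<^sup>2) \<le> 1" by simp
  have "(\<Sum>j\<in>F. (cmod (\<alpha> j))\<^sup>2 / (\<gamma> j)\<^sup>2) \<le> 1" if F: "finite F" for F
  proof -
    have "(\<Sum>j\<in>F. (cmod (\<alpha> j))\<^sup>2 / (\<gamma> j)\<^sup>2) = (\<Sum>j\<in>F \<inter> {j. \<gamma> j \<noteq> 0}. (cmod (\<alpha> j))\<^sup>2 / (\<gamma> j)\<^sup>2)"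
      by (rule sum.mono_neutral_right) (use F in auto)
    also have "\<dots> \<le> (\<Sum>\<^sub>\<infinity>j\<in>{j. \<gamma> j \<noteq> 0}. (cmod (\<alpha> j))\<^sup>2 / (\<gamma> j)\<^sup>2)"
      by (rule finite_sum_le_infsum) (use F \<alpha>(3) in auto)
    finally show ?thesis using le by simp
  qed
  then show ?thesis using that \<alpha>(1,2) by blast
qed

lemma has_sum_sum:
  fixes f :: "'i \<Rightarrow> 'a \<Rightarrow> 'b :: topological_comm_monoid_add"
  shows "finite I \<Longrightarrow> (\<And>i. i \<in> I \<Longrightarrow> (f i has_sum s i) A)
    \<Longrightarrow> ((\<lambda>x. \<Sum>i\<in>I. f i x) has_sum (\<Sum>i\<in>I. s i)) A"
  by (induction I rule: finite_induct) (simp_all add: has_sum_0 has_sum_add)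

section \<open>Aliasing at equidistant nodes\<close>

lemma fourier_exp_roots_of_unity:
  assumes n: "n \<ge> 1"
  shows "(\<Sum>i<n. fourier_exp j (real i / real n)) = (if int n dvd j then of_nat n else 0)"
proof -
  define \<omega> where "\<omega> = fourier_exp j (1 / real n)"
  have pow: "fourier_exp j (real i / real n) = \<omega> ^ i" for i
    unfolding \<omega>_def fourier_exp_def by (simp flip: exp_of_nat_mult add: mult_ac)
  have "\<omega> ^ n = exp (2 * of_int j * of_real pi * \<i>)"
    using pow[of n] n by (simp add: fourier_exp_def mult_ac)
  also have "\<dots> = 1" by (auto simp: exp_eq_1)
  finally have pn: "\<omega> ^ n = 1" .
  have "\<omega> = 1 \<longleftrightarrow> (\<exists>k. 2 * pi * real_of_int j / real n = real_of_int (2 * k) * pi)"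
    unfolding \<omega>_def fourier_exp_def exp_eq_1 by simp
  also have "\<dots> \<longleftrightarrow> (\<exists>k. real_of_int j = real_of_int (int n * k))"
    using n by (intro ex_cong1) (simp add: field_simps)
  also have "\<dots> \<longleftrightarrow> int n dvd j" unfolding of_int_eq_iff dvd_def ..
  finally have eq: "\<omega> = 1 \<longleftrightarrow> int n dvd j" .
  show ?thesis
  proof (cases "int n dvd j")
    case True
    then show ?thesis using eq by (simp add: pow)
  next
    case False
    then show ?thesis using eq pn by (simp add: pow geometric_sum)
  qed
qed

context doubling_weights
begin

lemma fourfold: "(b\<^sup>2)\<^sup>2 * (\<gamma> (int m))\<^sup>2 \<le> (\<gamma> (int (4 * m)))\<^sup>2"
proof -
  have "b\<^sup>2 * (b\<^sup>2 * (\<gamma> (int m))\<^sup>2) \<le> b\<^sup>2 * (\<gamma> (int (2 * m)))\<^sup>2"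
    by (intro mult_left_mono doubling_square) simp
  also have "\<dots> \<le> (\<gamma> (int (2 * (2 * m))))\<^sup>2" by (rule doubling_square)
  finally show ?thesis by (simp add: power2_eq_square mult_ac)
qed

text \<open>The term at \<open>2 * l * n\<close> is dominated by each of the \<open>n\<close> terms
  ending there, those with index above \<open>(2 * l - 1) * n\<close>. These blocks are disjoint and
  lie above \<open>n\<close>. With all multiples \<open>l * n\<close> instead, the first block would
  be 1 to \<open>n\<close>, outside the tail.\<close>

lemma sum_multiples_le_tail: "real n * (\<Sum>l\<in>{1..<Suc N}. (\<gamma> (int (2 * l * n)))\<^sup>2) \<le> tail n"
proof -
  let ?g = "\<lambda>j. (\<gamma> (int j))\<^sup>2"
  have "real n * (\<Sum>l\<in>{1..<Suc N}. ?g (2 * l * n)) \<le> (\<Sum>j\<in>{Suc n..<Suc (2 * N * n)}. ?g j)"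
  proof (induction N)
    case (Suc N)
    have "1 \<le> Suc N" by simp
    note split = sum.atLeastLessThan_Suc[OF this, THEN arg_cong, of "(*) (real n)" "\<lambda>l. ?g (2 * l * n)",
        unfolded distrib_left]
    have "real n * ?g (2 * Suc N * n) = (\<Sum>j\<in>{Suc ((2 * N + 1) * n)..<Suc (2 * Suc N * n)}. ?g (2 * Suc N * n))"
      by (simp add: algebra_simps)
    also have "\<dots> \<le> (\<Sum>j\<in>{Suc ((2 * N + 1) * n)..<Suc (2 * Suc N * n)}. ?g j)"
      by (intro sum_mono antimonoD[OF decreasing_square]) auto
    finally have "real n * (\<Sum>l\<in>{1..<Suc (Suc N)}. ?g (2 * l * n))
        \<le> (\<Sum>j\<in>{Suc n..<Suc (2 * N * n)}. ?g j) + (\<Sum>j\<in>{Suc ((2 * N + 1) * n)..<Suc (2 * Suc N * n)}. ?g j)"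
      using Suc split by linarith
    also have "\<dots> = (\<Sum>j\<in>{Suc n..<Suc (2 * N * n)} \<union> {Suc ((2 * N + 1) * n)..<Suc (2 * Suc N * n)}. ?g j)"
      by (rule sum.union_disjoint[symmetric]) (auto simp: algebra_simps)
    also have "\<dots> \<le> (\<Sum>j\<in>{Suc n..<Suc (2 * Suc N * n)}. ?g j)"
      by (rule sum_mono2) (auto simp: algebra_simps)
    finally show ?case .
  qed simp
  also have "\<dots> \<le> tail n" by (rule partial_tail_le)
  finally show ?thesis .
qed

text \<open>Write \<open>j = k + l * n\<close> with \<open>l \<noteq> 0\<close>. Since
  \<open>k\<close> is at most half of \<open>n\<close>, one gets
  \<open>\<bar>l\<bar> * n \<le> 2 * \<bar>j\<bar>\<close>, so \<open>fourfold\<close> compares the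
  weight at \<open>j\<close> with the one at the even multiple \<open>2 * \<bar>l\<bar> * n\<close>,
  as \<open>sum_multiples_le_tail\<close> demands. The two signs of \<open>l\<close> account for the
  2, the two doublings for the power of \<open>b\<close>.\<close>

lemma aliasing_sum_le:
  assumes n: "n \<ge> 1" and k: "2 * \<bar>k\<bar> \<le> int n"
    and F: "finite F" "\<And>j. j \<in> F \<Longrightarrow> j \<noteq> k \<and> int n dvd j - k"
  shows "(\<Sum>j\<in>F. (\<gamma> j)\<^sup>2) \<le> 2 / (b\<^sup>2)\<^sup>2 * (tail n / real n)"
proof -
  define l where "l j = (j - k) div int n" for j
  have l: "j = k + l j * int n" if "j \<in> F" for j
    using F(2)[OF that] by (simp add: l_def)
  have l0: "l j \<noteq> 0" if "j \<in> F" for j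
    using F(2)[OF that] l[OF that] by auto
  have inj: "inj_on l F" using l by (metis inj_onI)
  \<comment> \<open>The alias \<open>l = 0\<close> is \<open>k\<close> itself, which
    \<open>F\<close> excludes; the value 0 there removes the central term of the symmetric
    sum.\<close>
  define h where "h l = (if l = 0 then 0 else (\<gamma> (int (2 * nat \<bar>l\<bar> * n)))\<^sup>2)" for l :: int
  have le: "(b\<^sup>2)\<^sup>2 * (\<gamma> j)\<^sup>2 \<le> h (l j)" if j: "j \<in> F" for j
  proof -
    have "\<bar>l j\<bar> * int n = \<bar>j - k\<bar>"
      using l[OF j] by (metis abs_mult abs_of_nat add_diff_cancel_left')
    moreover have "1 * int n \<le> \<bar>l j\<bar> * int n" using l0[OF j] by (intro mult_right_mono) auto
    ultimately have "\<bar>l j\<bar> * int n \<le> 2 * \<bar>j\<bar>" using k by linarith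
    then have "int (2 * nat \<bar>l j\<bar> * n) \<le> int (4 * nat \<bar>j\<bar>)" by (simp add: mult.commute)
    then have "2 * nat \<bar>l j\<bar> * n \<le> 4 * nat \<bar>j\<bar>" by linarith
    then have "(\<gamma> (int (4 * nat \<bar>j\<bar>)))\<^sup>2 \<le> h (l j)"
      using l0[OF j] antimonoD[OF decreasing_square] unfolding h_def by metis
    then show ?thesis using fourfold[of "nat \<bar>j\<bar>"] gamma_abs[of j] by simp
  qed
  obtain N where N: "\<And>j. j \<in> F \<Longrightarrow> \<bar>l j\<bar> < int (Suc N)"
  proof -
    have "\<bar>l j\<bar> < int (Suc (nat (Max ((\<lambda>j. \<bar>l j\<bar>) ` F))))" if "j \<in> F" for j
    proof -
      have "\<bar>l j\<bar> \<le> Max ((\<lambda>j. \<bar>l j\<bar>) ` F)" using F(1) that by (intro Max_ge) auto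
      then show ?thesis by linarith
    qed
    then show ?thesis using that by blast
  qed
  have "(b\<^sup>2)\<^sup>2 * (\<Sum>j\<in>F. (\<gamma> j)\<^sup>2) \<le> (\<Sum>j\<in>F. h (l j))"
    unfolding sum_distrib_left by (rule sum_mono) (rule le)
  also have "\<dots> = (\<Sum>i\<in>l ` F. h i)" by (simp add: sum.reindex[OF inj])
  also have "\<dots> \<le> (\<Sum>i\<in>{- int (Suc N)<..<int (Suc N)}. h i)"
    by (rule sum_mono2) (use N in \<open>fastforce simp: h_def abs_less_iff\<close>)+
  also have "\<dots> = 2 * (\<Sum>l\<in>{1..<Suc N}. (\<gamma> (int (2 * l * n)))\<^sup>2)"
    by (subst sum_symmetric_interval) (auto simp: h_def sum_distrib_left intro!: sum.cong)
  also have "\<dots> \<le> 2 * (tail n / real n)"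
    using sum_multiples_le_tail[of n N] n by (simp add: field_simps)
  finally have "(b\<^sup>2)\<^sup>2 * (\<Sum>j\<in>F. (\<gamma> j)\<^sup>2) \<le> 2 * (tail n / real n)" .
  moreover have "0 < (b\<^sup>2)\<^sup>2" using b_pos by simp
  ultimately have "(\<Sum>j\<in>F. (\<gamma> j)\<^sup>2) \<le> 2 * (tail n / real n) / (b\<^sup>2)\<^sup>2"
    by (simp only: pos_le_divide_eq mult.commute)
  then show ?thesis by (simp add: mult.commute)
qed

text \<open>A complete residue system modulo \<open>n\<close>, centred so that absolute values stay
  at most \<open>n / 2\<close>, as the aliasing estimate requires. For even \<open>n\<close> the
  asymmetry keeps the number of elements equal to \<open>n\<close>.\<close>

definition frequencies :: "nat \<Rightarrow> int set" where
  "frequencies n = {- int (n div 2)..<int n - int (n div 2)}"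

lemma frequencies_bound: "k \<in> frequencies n \<Longrightarrow> 2 * \<bar>k\<bar> \<le> int n"
  unfolding frequencies_def by auto

lemma frequencies_unique:
  assumes "k \<in> frequencies n" "k' \<in> frequencies n" "int n dvd k - k'"
  shows "k = k'"
proof (rule ccontr)
  assume "k \<noteq> k'"
  then have "int n \<le> \<bar>k - k'\<bar>" using zdvd_imp_le[of "int n" "\<bar>k - k'\<bar>"] assms(3) by simp
  then show False using assms(1,2) by (auto simp: frequencies_def)
qed

lemma exists_frequency:
  assumes "n \<ge> 1"
  shows "\<exists>k\<in>frequencies n. int n dvd j - k"
proof
  let ?k = "(j + int (n div 2)) mod int n - int (n div 2)"
  show "?k \<in> frequencies n" using assms by (simp add: frequencies_def)
  have "j - ?k = (j + int (n div 2)) - (j + int (n div 2)) mod int n" by simp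
  then show "int n dvd j - ?k" by (metis dvd_minus_mod)
qed

text \<open>The functions \<open>g i\<close> are the cardinal functions of trigonometric
  interpolation. Coefficients in the window err by their aliases, those outside are lost; each of
  the two contributions to the squared error is at most \<open>G\<close>.\<close>

lemma sampling_number_le:
  assumes n: "n \<ge> 1"
  shows "sampling_number n \<gamma> \<le> ennreal (sqrt (4 / (b\<^sup>2)\<^sup>2) * sqrt (tail n / real n))"
proof -
  define t where "t i = real i / real n" for i
  define g where "g i x = (\<Sum>k\<in>frequencies n. (fourier_exp (- k) (t i) / of_nat n) * fourier_exp k x)" for i x
  have fin: "finite (frequencies n)" by (simp add: frequencies_def)
  have "sampling_number n \<gamma> \<le> (SUP f \<in> H_ball \<gamma>. ennreal (L2_norm (\<lambda>x. f x - (\<Sum>i<n. f (t i) * g i x))))"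
    unfolding sampling_number_def
  proof (rule INF_lower2[of "(t, g)"])
    have "g i \<in> L2_space" for i
      unfolding g_def by (intro L2_space_sum fin L2_spaceI_bounded[of _ 1]) auto
    then show "(t, g) \<in> {(t, g). \<forall>i<n. t i \<in> {0..1} \<and> g i \<in> L2_space}"
      by (auto simp: t_def)
  qed auto
  also have "\<dots> \<le> ennreal (sqrt (4 / (b\<^sup>2)\<^sup>2) * sqrt (tail n / real n))"
  proof (rule SUP_least, rule ennreal_leI)
    fix f assume "f \<in> H_ball \<gamma>"
    then obtain \<alpha> where \<alpha>: "is_fourier_series \<alpha> f" "\<And>j. \<gamma> j = 0 \<Longrightarrow> \<alpha> j = 0"
      "\<And>F. finite F \<Longrightarrow> (\<Sum>j\<in>F. (cmod (\<alpha> j))\<^sup>2 / (\<gamma> j)\<^sup>2) \<le> 1"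
      using H_ball_coefficients[of f \<gamma>] by metis
    define \<beta> where "\<beta> j = (cmod (\<alpha> j))\<^sup>2 / (\<gamma> j)\<^sup>2" for j
    define G where "G = 2 / (b\<^sup>2)\<^sup>2 * (tail n / real n)"
    have G: "0 \<le> G" unfolding G_def using tail_nonneg by simp
    have \<alpha>\<beta>: "(cmod (\<alpha> j))\<^sup>2 = (\<gamma> j)\<^sup>2 * \<beta> j" for j
      using \<alpha>(2)[of j] by (simp add: \<beta>_def)
    have \<beta>0: "0 \<le> \<beta> j" for j by (simp add: \<beta>_def)
    define s where "s k = (\<Sum>i<n. f (t i) * (fourier_exp (- k) (t i) / of_nat n))" for k
    \<comment> \<open>Discrete orthogonality: the computed coefficient at \<open>k\<close> is the
      sum of \<open>\<alpha>\<close> over the whole residue class of \<open>k\<close>.\<close>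
    have s: "((\<lambda>j. if int n dvd j - k then \<alpha> j else 0) has_sum s k) UNIV" for k
    proof -
      have "((\<lambda>j. \<Sum>i<n. \<alpha> j * fourier_exp j (t i) * (fourier_exp (- k) (t i) / of_nat n)) has_sum s k) UNIV"
        unfolding s_def using \<alpha>(1)
        by (intro has_sum_sum has_sum_cmult_left) (auto simp: is_fourier_series_def)
      moreover have "(\<Sum>i<n. \<alpha> j * fourier_exp j (t i) * (fourier_exp (- k) (t i) / of_nat n))
          = (if int n dvd j - k then \<alpha> j else 0)" for j
      proof -
        have "(\<Sum>i<n. \<alpha> j * fourier_exp j (t i) * (fourier_exp (- k) (t i) / of_nat n))
            = \<alpha> j * (\<Sum>i<n. fourier_exp (j - k) (t i)) / of_nat n"
          unfolding sum_distrib_left sum_divide_distrib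
          using fourier_exp_mult[of j _ "- k"] by (intro sum.cong refl) (simp add: mult.assoc)
        then show ?thesis using fourier_exp_roots_of_unity[OF n, of "j - k"] n by (simp add: t_def)
      qed
      ultimately show ?thesis by simp
    qed
    define d where "d k = \<alpha> k - (if k \<in> frequencies n then s k else 0)" for k
    have ser: "is_fourier_series d (\<lambda>x. f x - (\<Sum>i<n. f (t i) * g i x))"
    proof -
      have "(\<Sum>i<n. f (t i) * g i x)
          = (\<Sum>k\<in>frequencies n. (if k \<in> frequencies n then s k else 0) * fourier_exp k x)" for x
        unfolding g_def s_def sum_distrib_left sum_distrib_right
        by (subst sum.swap) (simp add: mult_ac sum_distrib_right sum_distrib_left)
      then show ?thesis
        unfolding d_def
        using is_fourier_series_diff[OF \<alpha>(1) is_fourier_series_trig_poly[OF fin, of "\<lambda>k. if k \<in> frequencies n then s k else 0"]]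
        by simp
    qed
    \<comment> \<open>A frequency outside the window is an alias of some \<open>k\<close> inside it,
      so the aliasing estimate for a singleton bounds its squared weight by
      \<open>G\<close>.\<close>
    have high: "(cmod (d j))\<^sup>2 \<le> G * \<beta> j" if j: "j \<notin> frequencies n" for j
    proof -
      obtain k where k: "k \<in> frequencies n" "int n dvd j - k" using exists_frequency[OF n] by blast
      have "(\<Sum>j\<in>{j}. (\<gamma> j)\<^sup>2) \<le> G"
        unfolding G_def by (rule aliasing_sum_le[OF n frequencies_bound[OF k(1)]]) (use j k in auto)
      then show ?thesis using j \<beta>0[of j] by (auto simp: d_def \<alpha>\<beta> intro: mult_right_mono)
    qed
    \<comment> \<open>Cauchy-Schwarz acts in each residue class separately. The classes are
      disjoint, so their sums of \<open>\<beta>\<close> add up to at most 1 and no factor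
      \<open>n\<close> appears. The sets \<open>A k m\<close> are finite sections of the classes, so
      that only finite sums are estimated.\<close>
    have low: "(\<Sum>k\<in>K. (cmod (d k))\<^sup>2) \<le> G" if K: "finite K" "K \<subseteq> frequencies n" for K
    proof -
      define A where "A k m = {j \<in> {- int m..int m}. j \<noteq> k \<and> int n dvd j - k}" for k m
      have finA: "finite (A k m)" for k m
        by (rule finite_subset[of _ "{- int m..int m}"]) (auto simp: A_def)
      have lim: "(\<lambda>m. - (\<Sum>j\<in>A k m. \<alpha> j)) \<longlonglongrightarrow> d k" if k: "k \<in> K" for k
      proof -
        have "((\<lambda>j. (if j = k then \<alpha> k else 0)) has_sum \<alpha> k) UNIV"
          by (rule has_sum_finite_neutralI[of "{k}"]) auto
        then have "((\<lambda>j. (if j = k then \<alpha> k else 0) + - (if int n dvd j - k then \<alpha> j else 0)) has_sum \<alpha> k + - s k) UNIV"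
          by (rule has_sum_add) (use s[of k] in \<open>simp add: has_sum_uminus\<close>)
        moreover have "\<alpha> k + - s k = d k" using k K by (auto simp: d_def)
        moreover have "(\<lambda>j. (if j = k then \<alpha> k else 0) + - (if int n dvd j - k then \<alpha> j else 0))
            = (\<lambda>j. if j \<noteq> k \<and> int n dvd j - k then - \<alpha> j else 0)" by auto
        ultimately have "((\<lambda>j. if j \<noteq> k \<and> int n dvd j - k then - \<alpha> j else 0) has_sum d k) UNIV" by simp
        then have "(sum (\<lambda>j. if j \<noteq> k \<and> int n dvd j - k then - \<alpha> j else 0) \<longlongrightarrow> d k) (finite_subsets_at_top UNIV)"
          unfolding has_sum_def .
        from filterlim_compose[OF this filterlim_symmetric_intervals]
        have "(\<lambda>m. \<Sum>j\<in>{- int m..int m}. if j \<noteq> k \<and> int n dvd j - k then - \<alpha> j else 0) \<longlonglongrightarrow> d k" .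
        moreover have "(\<Sum>j\<in>{- int m..int m}. if j \<noteq> k \<and> int n dvd j - k then - \<alpha> j else 0)
            = - (\<Sum>j\<in>A k m. \<alpha> j)" for m
          unfolding A_def sum_negf[symmetric] by (rule sum.inter_filter[symmetric]) simp
        ultimately show ?thesis by simp
      qed
      have "(\<lambda>m. \<Sum>k\<in>K. (cmod (- (\<Sum>j\<in>A k m. \<alpha> j)))\<^sup>2) \<longlonglongrightarrow> (\<Sum>k\<in>K. (cmod (d k))\<^sup>2)"
        by (intro tendsto_sum tendsto_power tendsto_norm lim)
      then show ?thesis
      proof (rule Lim_bounded, intro allI impI)
        fix m
        have "(\<Sum>k\<in>K. (cmod (- (\<Sum>j\<in>A k m. \<alpha> j)))\<^sup>2) \<le> (\<Sum>k\<in>K. G * (\<Sum>j\<in>A k m. \<beta> j))"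
        proof (rule sum_mono)
          fix k assume k: "k \<in> K"
          have "cmod (\<Sum>j\<in>A k m. \<alpha> j) \<le> (\<Sum>j\<in>A k m. \<gamma> j * sqrt (\<beta> j))"
          proof (rule order_trans[OF norm_sum], rule sum_mono)
            fix j
            show "cmod (\<alpha> j) \<le> \<gamma> j * sqrt (\<beta> j)"
              using \<alpha>(2)[of j] nonneg[of j] by (simp add: \<beta>_def real_sqrt_divide)
          qed
          then have "(cmod (- (\<Sum>j\<in>A k m. \<alpha> j)))\<^sup>2 \<le> (\<Sum>j\<in>A k m. \<gamma> j * sqrt (\<beta> j))\<^sup>2"
            by (simp add: power_mono)
          also have "\<dots> \<le> (\<Sum>j\<in>A k m. (\<gamma> j)\<^sup>2) * (\<Sum>j\<in>A k m. (sqrt (\<beta> j))\<^sup>2)"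
            by (rule Cauchy_Schwarz_ineq_sum)
          also have "\<dots> \<le> G * (\<Sum>j\<in>A k m. \<beta> j)"
          proof (rule mult_mono)
            show "(\<Sum>j\<in>A k m. (\<gamma> j)\<^sup>2) \<le> G"
              unfolding G_def
              by (rule aliasing_sum_le[OF n frequencies_bound finA]) (use k K in \<open>auto simp: A_def\<close>)
          qed (use G \<beta>0 in \<open>auto intro: sum_nonneg\<close>)
          finally show "(cmod (- (\<Sum>j\<in>A k m. \<alpha> j)))\<^sup>2 \<le> G * (\<Sum>j\<in>A k m. \<beta> j)" .
        qed
        also have "\<dots> = G * (\<Sum>j\<in>(\<Union>k\<in>K. A k m). \<beta> j)"
          unfolding sum_distrib_left[symmetric]
        proof (subst sum.UNION_disjoint)
          show "\<forall>k\<in>K. \<forall>k'\<in>K. k \<noteq> k' \<longrightarrow> A k m \<inter> A k' m = {}"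
          proof (intro ballI impI, rule ccontr)
            fix k k' assume kk: "k \<in> K" "k' \<in> K" "k \<noteq> k'" "A k m \<inter> A k' m \<noteq> {}"
            then obtain j where "int n dvd j - k" "int n dvd j - k'" by (auto simp: A_def)
            then have "int n dvd (j - k') - (j - k)" by (rule dvd_diff[rotated])
            then show False using frequencies_unique[of k n k'] kk K by auto
          qed
        qed (use K finA in auto)
        also have "\<dots> \<le> G * 1"
          unfolding \<beta>_def using K finA G by (intro mult_left_mono \<alpha>(3)) auto
        finally show "(\<Sum>k\<in>K. (cmod (- (\<Sum>j\<in>A k m. \<alpha> j)))\<^sup>2) \<le> G" by simp
      qed
    qed
    have "L2_norm (\<lambda>x. f x - (\<Sum>i<n. f (t i) * g i x)) \<le> sqrt (2 * G)"
    proof (rule L2_norm_le[OF ser])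
      fix F :: "int set" assume F: "finite F"
      have "(\<Sum>j\<in>F. (cmod (d j))\<^sup>2)
          = (\<Sum>j\<in>F \<inter> frequencies n. (cmod (d j))\<^sup>2) + (\<Sum>j\<in>F - frequencies n. (cmod (d j))\<^sup>2)"
        by (rule sum.Int_Diff[OF F])
      also have "(\<Sum>j\<in>F - frequencies n. (cmod (d j))\<^sup>2) \<le> (\<Sum>j\<in>F - frequencies n. G * \<beta> j)"
        by (rule sum_mono) (use high in auto)
      also have "\<dots> \<le> G * 1"
        unfolding sum_distrib_left[symmetric] \<beta>_def using F G by (intro mult_left_mono \<alpha>(3)) auto
      also have "(\<Sum>j\<in>F \<inter> frequencies n. (cmod (d j))\<^sup>2) \<le> G" using F by (intro low) auto
      finally show "(\<Sum>j\<in>F. (cmod (d j))\<^sup>2) \<le> (sqrt (2 * G))\<^sup>2" using G by simp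
    qed (use G in simp)
    also have "sqrt (2 * G) = sqrt (4 / (b\<^sup>2)\<^sup>2) * sqrt (tail n / real n)"
      by (simp add: G_def flip: real_sqrt_mult)
    finally show "L2_norm (\<lambda>x. f x - (\<Sum>i<n. f (t i) * g i x)) \<le> sqrt (4 / (b\<^sup>2)\<^sup>2) * sqrt (tail n / real n)" .
  qed
  finally show ?thesis .
qed

end

section \<open>Approximation numbers and logarithmic weights\<close>

text \<open>Linearity is available only inside \<open>H_space \<gamma>\<close>, so the induction has
  to know that every partial sum belongs to it; the empty sum settles the zero function.\<close>

lemma H_linear_functional_sum:
  assumes L: "H_linear_functional \<gamma> L" and F: "finite F"
    and H: "\<And>G c. G \<subseteq> F \<Longrightarrow> (\<lambda>x. \<Sum>a\<in>G. c a * h a x) \<in> H_space \<gamma>"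
  shows "L (\<lambda>x. \<Sum>a\<in>F. c a * h a x) = (\<Sum>a\<in>F. c a * L (h a))"
proof -
  have cm: "c * L f = L (\<lambda>x. c * f x)" if "f \<in> H_space \<gamma>" for c f
    using L that by (simp add: H_linear_functional_def)
  have ad: "L (\<lambda>x. f x + g x) = L f + L g" if "f \<in> H_space \<gamma>" "g \<in> H_space \<gamma>" for f g
    using L that by (simp add: H_linear_functional_def)
  have "L (\<lambda>x. \<Sum>a\<in>G. c a * h a x) = (\<Sum>a\<in>G. c a * L (h a))" if "G \<subseteq> F" for G
    using finite_subset[OF that F] that
  proof (induction G rule: finite_induct)
    case empty
    have "(\<lambda>x. 0) \<in> H_space \<gamma>" using H[of "{}"] by simp
    then have "L (\<lambda>x. 0) = 0" using cm[of "\<lambda>x. 0" 0] by simp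
    then show ?case by simp
  next
    case (insert a G)
    have ha: "h a \<in> H_space \<gamma>" using H[of "{a}" "\<lambda>_. 1"] insert by simp
    have ca: "(\<lambda>x. c a * h a x) \<in> H_space \<gamma>" using H[of "{a}" c] insert by simp
    have G: "(\<lambda>x. \<Sum>a\<in>G. c a * h a x) \<in> H_space \<gamma>" using H[of G c] insert by simp
    have "L (\<lambda>x. \<Sum>a\<in>insert a G. c a * h a x) = L (\<lambda>x. c a * h a x + (\<Sum>a\<in>G. c a * h a x))"
      using insert by simp
    also have "\<dots> = c a * L (h a) + (\<Sum>a\<in>G. c a * L (h a))"
      using ad[OF ca G] cm[OF ha, of "c a"] insert by simp
    finally show ?case using insert by simp
  qed
  then show ?thesis by blast
qed

lemma trig_poly_in_H_space:
  assumes F: "finite F" and \<gamma>: "\<And>j. j \<in> F \<Longrightarrow> \<gamma> j \<noteq> 0"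
  shows "(\<lambda>x. \<Sum>j\<in>F. \<alpha> j * fourier_exp j x) \<in> H_space \<gamma>"
proof -
  define \<beta> where "\<beta> j = (if j \<in> F then \<alpha> j else 0)" for j
  have "is_fourier_series \<beta> (\<lambda>x. \<Sum>j\<in>F. \<beta> j * fourier_exp j x)"
    by (rule is_fourier_series_trig_poly[OF F]) (simp add: \<beta>_def)
  also have "(\<lambda>x. \<Sum>j\<in>F. \<beta> j * fourier_exp j x) = (\<lambda>x. \<Sum>j\<in>F. \<alpha> j * fourier_exp j x)"
    by (simp add: \<beta>_def)
  finally have "is_fourier_series \<beta> (\<lambda>x. \<Sum>j\<in>F. \<alpha> j * fourier_exp j x)" .
  moreover have "(\<lambda>j. (cmod (\<beta> j))\<^sup>2 / (\<gamma> j)\<^sup>2) summable_on {j. \<gamma> j \<noteq> 0}"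
    by (rule has_sum_imp_summable, rule has_sum_finite_neutralI[of F])
      (use F \<gamma> in \<open>auto simp: \<beta>_def\<close>)
  moreover have "\<forall>j. \<gamma> j = 0 \<longrightarrow> \<beta> j = 0" using \<gamma> by (auto simp: \<beta>_def)
  ultimately show ?thesis unfolding H_space_def by blast
qed

lemma H_linear_functional_fourier_coeffs: "H_linear_functional \<gamma> (\<lambda>f. fourier_coeffs f k)"
  unfolding H_linear_functional_def H_space_def
  by (auto simp: fourier_coeffs_eq fourier_coeffs_eq[OF is_fourier_series_add]
      fourier_coeffs_eq[OF is_fourier_series_cmult])

context doubling_weights
begin

text \<open>On the span of the frequencies 0 to \<open>n\<close> the L2 norm is at least
  \<open>\<gamma> (int n)\<close> times \<open>H_norm\<close>. This span has dimension
  \<open>n + 1\<close>, so \<open>n\<close> functionals have a common nonzero kernel element in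
  it.\<close>

lemma approx_number_ge: "ennreal (\<gamma> (int n)) \<le> approx_number n \<gamma>"
proof (cases "\<gamma> (int n) = 0")
  case False
  then have pos: "\<gamma> (int n) > 0" using nonneg[of "int n"] by simp
  define A where "A = {0..int n}"
  have A: "finite A" "n < card A" by (simp_all add: A_def)
  have ge: "\<gamma> a \<ge> \<gamma> (int n)" if "a \<in> A" for a
    using antimonoD[OF decreasing, of "nat a" n] that by (auto simp: A_def)
  have ne: "\<gamma> a \<noteq> 0" if "a \<in> A" for a using ge[OF that] pos by simp
  show ?thesis
    unfolding approx_number_def
  proof (intro INF_greatest, clarify)
    fix L :: "nat \<Rightarrow> (real \<Rightarrow> complex) \<Rightarrow> complex" and g :: "nat \<Rightarrow> real \<Rightarrow> complex"
    assume Lg: "\<forall>i<n. H_linear_functional \<gamma> (L i) \<and> g i \<in> L2_space"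
    \<comment> \<open>\<open>hdot\<close> conjugates its second argument; the inner
      \<open>cnj\<close> undoes this, so orthogonality says that a linear combination of values of
      \<open>L i\<close> vanishes.\<close>
    obtain x where x: "\<And>i. i < n \<Longrightarrow> hdot A x (\<lambda>a. cnj (L i (fourier_exp a))) = 0" "\<exists>a\<in>A. x a \<noteq> 0"
      using exists_orthogonal_vector[OF A, of "\<lambda>i a. cnj (L i (fourier_exp a))"] by metis
    define S where "S = (\<Sum>a\<in>A. (cmod (x a))\<^sup>2 / (\<gamma> a)\<^sup>2)"
    have S: "S > 0"
    proof -
      obtain a where a: "a \<in> A" "x a \<noteq> 0" using x(2) by blast
      then have "0 < (cmod (x a))\<^sup>2 / (\<gamma> a)\<^sup>2" using ne by simp
      also have "\<dots> \<le> S" unfolding S_def using A a by (intro member_le_sum) auto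
      finally show ?thesis .
    qed
    define \<alpha> where "\<alpha> a = (if a \<in> A then x a / of_real (sqrt S) else 0)" for a
    have \<alpha>: "(cmod (\<alpha> a))\<^sup>2 = (cmod (x a))\<^sup>2 / S" if "a \<in> A" for a
      using that S by (simp add: \<alpha>_def norm_divide power_divide)
    have "(\<Sum>a\<in>A. (cmod (\<alpha> a))\<^sup>2 / (\<gamma> a)\<^sup>2) = (\<Sum>a\<in>A. (cmod (x a))\<^sup>2 / (\<gamma> a)\<^sup>2 / S)"
      by (rule sum.cong) (simp_all add: \<alpha>)
    also have "\<dots> = S / S" by (simp only: S_def sum_divide_distrib)
    finally have 1: "(\<Sum>a\<in>A. (cmod (\<alpha> a))\<^sup>2 / (\<gamma> a)\<^sup>2) = 1" using S by simp
    define f where "f = (\<lambda>t. \<Sum>a\<in>A. \<alpha> a * fourier_exp a t)"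
    have f: "f \<in> H_ball \<gamma>"
      unfolding f_def by (rule trig_poly_in_H_ball[OF A(1)]) (use 1 ne in \<open>auto simp: \<alpha>_def\<close>)
    have Lf: "L i f = 0" if i: "i < n" for i
    proof -
      have "L i f = (\<Sum>a\<in>A. \<alpha> a * L i (fourier_exp a))"
        unfolding f_def
      proof (rule H_linear_functional_sum)
        show "H_linear_functional \<gamma> (L i)" using Lg i by blast
        show "(\<lambda>t. \<Sum>a\<in>G. c a * fourier_exp a t) \<in> H_space \<gamma>" if "G \<subseteq> A" for G c
          by (rule trig_poly_in_H_space) (use that A ne in \<open>auto intro: finite_subset\<close>)
      qed (rule A)
      also have "\<dots> = (\<Sum>a\<in>A. x a * L i (fourier_exp a) / of_real (sqrt S))"
        by (rule sum.cong) (auto simp: \<alpha>_def)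
      also have "\<dots> = hdot A x (\<lambda>a. cnj (L i (fourier_exp a))) / of_real (sqrt S)"
        by (simp add: hdot_def sum_divide_distrib)
      finally show ?thesis using x(1)[OF i] by simp
    qed
    have "(\<gamma> (int n))\<^sup>2 * (\<Sum>a\<in>A. (cmod (\<alpha> a))\<^sup>2 / (\<gamma> a)\<^sup>2) \<le> (\<Sum>a\<in>A. (cmod (\<alpha> a))\<^sup>2)"
      unfolding sum_distrib_left
    proof (rule sum_mono)
      fix a assume a: "a \<in> A"
      have "(\<gamma> (int n))\<^sup>2 * ((cmod (\<alpha> a))\<^sup>2 / (\<gamma> a)\<^sup>2) \<le> (\<gamma> a)\<^sup>2 * ((cmod (\<alpha> a))\<^sup>2 / (\<gamma> a)\<^sup>2)"
        using ge[OF a] pos by (intro mult_right_mono power_mono) auto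
      then show "(\<gamma> (int n))\<^sup>2 * ((cmod (\<alpha> a))\<^sup>2 / (\<gamma> a)\<^sup>2) \<le> (cmod (\<alpha> a))\<^sup>2" using ne[OF a] by simp
    qed
    then have "\<gamma> (int n) \<le> L2_norm f"
      unfolding L2_norm_def f_def integral_norm2_trig_poly[OF A(1)] 1 by (intro real_le_rsqrt) simp
    \<comment> \<open>All functionals vanish at \<open>f\<close>, so the algorithm returns 0 and
      \<open>f\<close> is its own error.\<close>
    also have "f = (\<lambda>x. f x - (\<Sum>i<n. L i f * g i x))" by (simp add: Lf)
    finally show "ennreal (\<gamma> (int n)) \<le> (SUP f \<in> H_ball \<gamma>. ennreal (L2_norm (\<lambda>x. f x - (\<Sum>i<n. L i f * g i x))))"
      using f by (intro SUP_upper2[of f] ennreal_leI)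
  qed
qed simp

text \<open>The truncated Fourier series on the window loses only frequencies with
  \<open>n \<le> 2 * \<bar>j\<bar>\<close>, and one doubling compares their weights with
  \<open>\<gamma> (int n)\<close> at the cost of \<open>1 / b\<close>.\<close>

lemma approx_number_le: "approx_number n \<gamma> \<le> ennreal (1 / b * \<gamma> (int n))"
proof -
  define k where "k i = int i - int (n div 2)" for i
  have k: "bij_betw k {..<n} (frequencies n)"
    by (rule bij_betwI[where g = "\<lambda>j. nat (j + int (n div 2))"]) (auto simp: k_def frequencies_def)
  have fin: "finite (frequencies n)" by (simp add: frequencies_def)
  let ?L = "\<lambda>i f. fourier_coeffs f (k i)" and ?g = "\<lambda>i. fourier_exp (k i)"
  have "approx_number n \<gamma> \<le> (SUP f \<in> H_ball \<gamma>. ennreal (L2_norm (\<lambda>x. f x - (\<Sum>i<n. ?L i f * ?g i x))))"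
    unfolding approx_number_def
    by (rule INF_lower2[of "(?L, ?g)"])
      (auto simp: H_linear_functional_fourier_coeffs intro: L2_spaceI_bounded[of _ 1])
  also have "\<dots> \<le> ennreal (1 / b * \<gamma> (int n))"
  proof (rule SUP_least, rule ennreal_leI)
    fix f assume "f \<in> H_ball \<gamma>"
    then obtain \<alpha> where \<alpha>: "is_fourier_series \<alpha> f" "\<And>j. \<gamma> j = 0 \<Longrightarrow> \<alpha> j = 0"
      "\<And>F. finite F \<Longrightarrow> (\<Sum>j\<in>F. (cmod (\<alpha> j))\<^sup>2 / (\<gamma> j)\<^sup>2) \<le> 1"
      using H_ball_coefficients[of f \<gamma>] by metis
    let ?\<alpha> = "\<lambda>j. if j \<in> frequencies n then \<alpha> j else 0"
    have "(\<Sum>i<n. ?L i f * ?g i x) = (\<Sum>j\<in>frequencies n. ?\<alpha> j * fourier_exp j x)" for x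
      using sum.reindex_bij_betw[OF k, of "\<lambda>j. \<alpha> j * fourier_exp j x"]
      by (simp add: fourier_coeffs_eq[OF \<alpha>(1)])
    then have ser: "is_fourier_series (\<lambda>j. \<alpha> j - ?\<alpha> j) (\<lambda>x. f x - (\<Sum>i<n. ?L i f * ?g i x))"
      using is_fourier_series_diff[OF \<alpha>(1) is_fourier_series_trig_poly[OF fin, of ?\<alpha>]] by simp
    show "L2_norm (\<lambda>x. f x - (\<Sum>i<n. ?L i f * ?g i x)) \<le> 1 / b * \<gamma> (int n)"
    proof (rule L2_norm_le[OF ser])
      fix F :: "int set" assume F: "finite F"
      have "(cmod (\<alpha> j - ?\<alpha> j))\<^sup>2 \<le> (1 / b * \<gamma> (int n))\<^sup>2 * ((cmod (\<alpha> j))\<^sup>2 / (\<gamma> j)\<^sup>2)" for j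
      proof (cases "j \<in> frequencies n \<or> \<gamma> j = 0")
        case True
        then show ?thesis using \<alpha>(2)[of j] by auto
      next
        case False
        then have "n \<le> 2 * nat \<bar>j\<bar>" by (auto simp: frequencies_def)
        then have "\<gamma> (int (2 * nat \<bar>j\<bar>)) \<le> \<gamma> (int n)" by (rule antimonoD[OF decreasing])
        then have "b * \<gamma> j \<le> \<gamma> (int n)"
          using doubling[of "nat \<bar>j\<bar>"] gamma_abs[of j] by simp
        then have "\<gamma> j \<le> 1 / b * \<gamma> (int n)" using b_pos by (simp add: field_simps)
        then have "(\<gamma> j)\<^sup>2 * ((cmod (\<alpha> j))\<^sup>2 / (\<gamma> j)\<^sup>2) \<le> (1 / b * \<gamma> (int n))\<^sup>2 * ((cmod (\<alpha> j))\<^sup>2 / (\<gamma> j)\<^sup>2)"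
          using nonneg by (intro mult_right_mono power_mono) auto
        then show ?thesis using False by simp
      qed
      then have "(\<Sum>j\<in>F. (cmod (\<alpha> j - ?\<alpha> j))\<^sup>2)
          \<le> (1 / b * \<gamma> (int n))\<^sup>2 * (\<Sum>j\<in>F. (cmod (\<alpha> j))\<^sup>2 / (\<gamma> j)\<^sup>2)"
        unfolding sum_distrib_left by (rule sum_mono)
      also have "\<dots> \<le> (1 / b * \<gamma> (int n))\<^sup>2 * 1"
        by (intro mult_left_mono \<alpha>(3) F) simp
      finally show "(\<Sum>j\<in>F. (cmod (\<alpha> j - ?\<alpha> j))\<^sup>2) \<le> (1 / b * \<gamma> (int n))\<^sup>2" by simp
    qed (use b_pos nonneg in simp)
  qed
  finally show ?thesis .
qed

end

section \<open>Tails of logarithmic weights\<close>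

lemma log_tail_derivative:
  fixes \<beta> :: real
  assumes "\<beta> > 1/2" "x > 1"
  shows "((\<lambda>x. ln x powr (1 - 2 * \<beta>) / (2 * \<beta> - 1)) has_real_derivative - (1 / x * ln x powr (- 2 * \<beta>))) (at x)"
proof -
  have ln: "ln x > 0" using assms by simp
  have "((\<lambda>x. ln x powr (1 - 2 * \<beta>)) has_real_derivative
      (1 - 2 * \<beta>) * ln x powr (1 - 2 * \<beta> - 1) * (1 / x)) (at x)"
    using assms ln by (auto intro!: derivative_eq_intros)
  from DERIV_cdivide[OF this, of "2 * \<beta> - 1"]
  have "((\<lambda>x. ln x powr (1 - 2 * \<beta>) / (2 * \<beta> - 1)) has_real_derivative
      (1 - 2 * \<beta>) / (2 * \<beta> - 1) * (ln x powr (- 2 * \<beta>) * (1 / x))) (at x)"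
    by (simp add: mult.commute)
  moreover have "(1 - 2 * \<beta>) / (2 * \<beta> - 1) = - 1" using assms by (simp add: field_simps)
  ultimately show ?thesis by simp
qed

text \<open>The integral test in difference form: by the mean value theorem a unit difference of
  \<open>F\<close> is the value of the decreasing summand at an intermediate point. The bound
  \<open>k \<ge> 3\<close> keeps \<open>k - 1\<close> where the logarithm is positive.\<close>

lemma log_term_bounds:
  fixes \<beta> :: real and k :: nat
  defines "F \<equiv> \<lambda>x::real. ln x powr (1 - 2 * \<beta>) / (2 * \<beta> - 1)"
  assumes \<beta>: "\<beta> > 1/2" and k: "k \<ge> 3"
  shows "F (real k) - F (real (Suc k)) \<le> 1 / real k * ln (real k) powr (- 2 * \<beta>)"
    and "1 / real k * ln (real k) powr (- 2 * \<beta>) \<le> F (real (k - 1)) - F (real k)"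
proof -
  let ?h = "\<lambda>x. 1 / x * ln x powr (- 2 * \<beta>)"
  have h: "?h y \<le> ?h x" if "1 < x" "x \<le> y" for x y
    using that \<beta> by (intro mult_mono powr_mono2') (auto simp: field_simps)
  have mvt: "\<exists>z. x < z \<and> z < x + 1 \<and> F x - F (x + 1) = ?h z" if "x > 1" for x
  proof -
    have "\<exists>z. x < z \<and> z < x + 1 \<and> F (x + 1) - F x = (x + 1 - x) * - ?h z"
      unfolding F_def by (rule MVT2) (use that \<beta> log_tail_derivative in auto)
    then show ?thesis by (auto simp: algebra_simps)
  qed
  show "F (real k) - F (real (Suc k)) \<le> ?h (real k)"
    using mvt[of "real k"] h[of "real k"] k by (fastforce simp: add.commute)
  have "real (k - 1) + 1 = real k" using k by simp
  then show "?h (real k) \<le> F (real (k - 1)) - F (real k)"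
    using mvt[of "real (k - 1)"] h[of _ "real k"] k by fastforce
qed

text \<open>The termwise bounds telescope, and \<open>F\<close> tends to 0 because
  \<open>1 - 2 * \<beta>\<close> is negative.\<close>

lemma (in doubling_weights) log_tail_bounds:
  fixes \<beta> :: real
  defines "F \<equiv> \<lambda>x::real. ln x powr (1 - 2 * \<beta>) / (2 * \<beta> - 1)"
  assumes \<beta>: "\<beta> > 1/2" and k0: "k0 \<ge> 2"
    and \<gamma>: "\<And>k. k \<ge> k0 \<Longrightarrow> \<gamma> (int k) = real k powr (-1/2) * ln (real k) powr (-\<beta>)"
    and n: "n \<ge> k0"
  shows "F (real (Suc n)) \<le> tail n" and "tail n \<le> F (real n)"
proof -
  have sq: "(\<gamma> (int k))\<^sup>2 = 1 / real k * ln (real k) powr (- 2 * \<beta>)" if "k \<ge> k0" for k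
  proof -
    have "(real k powr (-1/2))\<^sup>2 = 1 / real k"
      using that k0 by (simp add: power2_eq_square powr_add[symmetric] powr_minus_divide)
    moreover have "(ln (real k) powr (-\<beta>))\<^sup>2 = ln (real k) powr (- 2 * \<beta>)"
      by (simp add: power2_eq_square powr_add[symmetric])
    ultimately show ?thesis unfolding \<gamma>[OF that] power_mult_distrib by simp
  qed
  have lim: "(\<lambda>i. F (real (m + i))) \<longlonglongrightarrow> 0" for m
  proof -
    have "filterlim (\<lambda>i. i + m) at_top sequentially" by (rule filterlim_add_const_nat_at_top)
    then have "filterlim (\<lambda>i. ln (real (i + m))) at_top sequentially"
      by (intro filterlim_compose[OF ln_at_top] filterlim_compose[OF filterlim_real_sequentially])
    then have "filterlim (\<lambda>i. ln (real (m + i))) at_top sequentially"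
      by (simp only: add.commute)
    then have "(\<lambda>i. ln (real (m + i)) powr (1 - 2 * \<beta>)) \<longlonglongrightarrow> 0"
      using \<beta> by (intro tendsto_neg_powr) auto
    from tendsto_divide[OF this tendsto_const, of "2 * \<beta> - 1"] show ?thesis
      using \<beta> by (simp add: F_def)
  qed
  have tel: "(\<lambda>i. F (real (m + i)) - F (real (m + Suc i))) sums F (real m)" for m
    using telescope_sums'[OF lim[of m]] by simp
  show "F (real (Suc n)) \<le> tail n"
  proof (rule sums_le[OF _ tel tail_sums])
    fix i
    show "F (real (Suc n + i)) - F (real (Suc n + Suc i)) \<le> (\<gamma> (int (Suc n + i)))\<^sup>2"
      using log_term_bounds(1)[OF \<beta>, of "Suc n + i"] sq[of "Suc n + i"] n k0 by (simp add: F_def)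
  qed
  show "tail n \<le> F (real n)"
  proof (rule sums_le[OF _ tail_sums tel])
    fix i
    show "(\<gamma> (int (Suc n + i)))\<^sup>2 \<le> F (real (n + i)) - F (real (n + Suc i))"
      using log_term_bounds(2)[OF \<beta>, of "Suc n + i"] sq[of "Suc n + i"] n k0 by (simp add: F_def)
  qed
qed

section \<open>Asymptotic equivalence and assembly of the rates\<close>

lemma asymp_equalI:
  assumes "c > 0" "C > 0" "\<forall>\<^sub>F n in sequentially. ennreal c * v n \<le> u n"
    "\<forall>\<^sub>F n in sequentially. u n \<le> ennreal C * v n"
  shows "u \<asymp> v"
  unfolding asymp_equal_def using assms(1,2) eventually_conj[OF assms(3,4)]
  by (auto simp: cofinite_eq_sequentially)

lemma asymp_equal_power2:
  assumes "u \<asymp> v"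
  shows "(\<lambda>n. (u n)\<^sup>2) \<asymp> (\<lambda>n. (v n)\<^sup>2)"
proof -
  obtain c C where cC: "c > 0" "C > 0"
    "\<forall>\<^sub>F n in sequentially. ennreal c * v n \<le> u n \<and> u n \<le> ennreal C * v n"
    using assms unfolding asymp_equal_def cofinite_eq_sequentially by blast
  have sq: "ennreal (a\<^sup>2) * (v n)\<^sup>2 = (ennreal a * v n)\<^sup>2" if "a > 0" for a n
    using that by (simp add: power_mult_distrib ennreal_power)
  show ?thesis
  proof (rule asymp_equalI)
    show "\<forall>\<^sub>F n in sequentially. ennreal (c\<^sup>2) * (v n)\<^sup>2 \<le> (u n)\<^sup>2"
      using cC(3) by eventually_elim (auto simp: sq[OF cC(1)] intro: power_mono)
    show "\<forall>\<^sub>F n in sequentially. (u n)\<^sup>2 \<le> ennreal (C\<^sup>2) * (v n)\<^sup>2"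
      using cC(3) by eventually_elim (auto simp: sq[OF cC(2)] intro: power_mono)
  qed (use cC in auto)
qed

text \<open>A bound from below on the smaller sequence and one from above on the larger determine
  both. The constant \<open>c / C\<close> arises from comparing \<open>v\<close> with
  \<open>u\<close> through \<open>w\<close>.\<close>

lemma asymp_equal_sandwich:
  fixes w :: "nat \<Rightarrow> real"
  assumes c: "c > 0" and C: "C > 0"
    and lower: "\<forall>\<^sub>F n in sequentially. ennreal (c * w n) \<le> u n"
    and mid: "\<And>n. u n \<le> v n"
    and upper: "\<forall>\<^sub>F n in sequentially. v n \<le> ennreal (C * w n)"
  shows "u \<asymp> v" and "v \<asymp> (\<lambda>n. ennreal (w n))"
proof -
  show "u \<asymp> v"
  proof (rule asymp_equalI[of "c / C" 1])
    show "\<forall>\<^sub>F n in sequentially. ennreal (c / C) * v n \<le> u n"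
      using lower upper
    proof eventually_elim
      case (elim n)
      have "ennreal (c / C) * v n \<le> ennreal (c / C) * ennreal (C * w n)"
        using elim by (intro mult_left_mono) auto
      also have "\<dots> = ennreal (c * w n)"
        using c C by (subst ennreal_mult'[symmetric]) auto
      finally show ?case using elim by simp
    qed
  qed (use c C mid in auto)
  show "v \<asymp> (\<lambda>n. ennreal (w n))"
  proof (rule asymp_equalI[OF c C])
    show "\<forall>\<^sub>F n in sequentially. ennreal c * ennreal (w n) \<le> v n"
      using lower by eventually_elim (use c mid order_trans in \<open>fastforce simp: ennreal_mult'\<close>)
    show "\<forall>\<^sub>F n in sequentially. v n \<le> ennreal C * ennreal (w n)"
      using upper by eventually_elim (use C in \<open>simp add: ennreal_mult'\<close>)
  qed
qed

context doubling_weights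
begin

text \<open>The relations are kept unsquared: the logarithmic case uses the first one as it stands,
  and \<open>asymp_equal_power2\<close> turns both into the squared claim.\<close>

lemma asymp_tail:
  shows "(\<lambda>n. integration_number n \<gamma>) \<asymp> (\<lambda>n. sampling_number n \<gamma>)"
    and "(\<lambda>n. sampling_number n \<gamma>) \<asymp> (\<lambda>n. ennreal (sqrt (tail n / real n)))"
proof -
  have c: "sqrt (b\<^sup>2 / 8) > 0" and C: "sqrt (4 / (b\<^sup>2)\<^sup>2) > 0" using b_pos by simp_all
  have upper: "\<forall>\<^sub>F n in sequentially. sampling_number n \<gamma> \<le> ennreal (sqrt (4 / (b\<^sup>2)\<^sup>2) * sqrt (tail n / real n))"
    using eventually_ge_at_top[of 1] by eventually_elim (rule sampling_number_le)
  note sandwich = asymp_equal_sandwich[OF c C eventually_integration_number_ge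
      integration_number_le_sampling_number upper]
  show "(\<lambda>n. integration_number n \<gamma>) \<asymp> (\<lambda>n. sampling_number n \<gamma>)"
    "(\<lambda>n. sampling_number n \<gamma>) \<asymp> (\<lambda>n. ennreal (sqrt (tail n / real n)))"
    by (fact sandwich)+
qed

lemma log_weights_asymp:
  assumes \<beta>: "\<beta> > 1/2" and k0: "k0 \<ge> 2"
    and \<gamma>: "\<And>k. k \<ge> k0 \<Longrightarrow> \<gamma> (int k) = real k powr (-1/2) * ln (real k) powr (-\<beta>)"
  shows "(\<lambda>n. approx_number n \<gamma>) \<asymp> (\<lambda>n. ennreal (real n powr (-1/2) * ln (real n) powr (-\<beta>)))"
    and "(\<lambda>n. sampling_number n \<gamma>) \<asymp> (\<lambda>n. ennreal (real n powr (-1/2) * ln (real n) powr (-\<beta> + 1/2)))"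
proof -
  show "(\<lambda>n. approx_number n \<gamma>) \<asymp> (\<lambda>n. ennreal (real n powr (-1/2) * ln (real n) powr (-\<beta>)))"
  proof (rule asymp_equal_sandwich(2)[of 1 "1 / b" _ "\<lambda>n. approx_number n \<gamma>"])
    show "\<forall>\<^sub>F n in sequentially. ennreal (1 * (real n powr (-1/2) * ln (real n) powr (-\<beta>))) \<le> approx_number n \<gamma>"
      using eventually_ge_at_top[of k0]
    proof eventually_elim
      case (elim n)
      then show ?case using approx_number_ge[of n] \<gamma>[OF elim] by simp
    qed
    show "\<forall>\<^sub>F n in sequentially. approx_number n \<gamma> \<le> ennreal (1 / b * (real n powr (-1/2) * ln (real n) powr (-\<beta>)))"
      using eventually_ge_at_top[of k0]
    proof eventually_elim
      case (elim n)
      then show ?case using approx_number_le[of n] \<gamma>[OF elim] by simp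
    qed
  qed (use b_pos in auto)
  define w where "w n = real n powr (-1/2) * ln (real n) powr (-\<beta> + 1/2)" for n
  \<comment> \<open>\<open>?A\<close> comes from the upper tail estimate at \<open>n\<close>. The
    lower estimate lives at \<open>Suc n\<close>, and the power of 2 in \<open>?B\<close> pays for
    moving it to \<open>n\<close>.\<close>
  let ?A = "1 / (2 * \<beta> - 1)" and ?B = "2 powr (1 - 2 * \<beta>) / (2 * \<beta> - 1)"
  have pos: "?A > 0" "?B > 0" using \<beta> by auto
  have w: "sqrt (a * ln (real n) powr (1 - 2 * \<beta>) / real n) = sqrt a * w n" for a n
  proof -
    have "sqrt (ln (real n) powr (1 - 2 * \<beta>)) = (ln (real n) powr (1 - 2 * \<beta>)) powr (1/2)"
      by (rule powr_half_sqrt[symmetric]) simp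
    also have "\<dots> = ln (real n) powr ((1 - 2 * \<beta>) * (1/2))" by (rule powr_powr)
    also have "(1 - 2 * \<beta>) * (1/2) = -\<beta> + 1/2" by (simp add: left_diff_distrib)
    finally have 1: "sqrt (ln (real n) powr (1 - 2 * \<beta>)) = ln (real n) powr (-\<beta> + 1/2)" .
    have "real n powr (-1/2) = real n powr (- (1/2))" by simp
    also have "\<dots> = 1 / sqrt (real n)" unfolding powr_minus_divide by (simp add: powr_half_sqrt)
    finally have 2: "real n powr (-1/2) = 1 / sqrt (real n)" .
    show ?thesis
      unfolding w_def real_sqrt_mult real_sqrt_divide 1 2 by simp
  qed
  have bounds: "\<forall>\<^sub>F n in sequentially. sqrt ?B * w n \<le> sqrt (tail n / real n) \<and> sqrt (tail n / real n) \<le> sqrt ?A * w n"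
    using eventually_ge_at_top[of k0]
  proof eventually_elim
    case (elim n)
    then have n: "n \<ge> 2" using k0 by simp
    \<comment> \<open>For \<open>n \<ge> 2\<close> the successor of \<open>n\<close> is at most its
      square, so the logarithm at most doubles; the negative exponent reverses the
      inequality.\<close>
    have "2 * real n \<le> real n * real n" using n by (intro mult_right_mono) auto
    then have "real (Suc n) \<le> real n * real n" using n by linarith
    then have "ln (real (Suc n)) \<le> ln (real n * real n)" using n by (subst ln_le_cancel_iff) auto
    also have "\<dots> = 2 * ln (real n)" using n by (simp add: ln_mult)
    finally have "(2 * ln (real n)) powr (1 - 2 * \<beta>) \<le> ln (real (Suc n)) powr (1 - 2 * \<beta>)"
      using n \<beta> by (intro powr_mono2') auto
    then have "?B * ln (real n) powr (1 - 2 * \<beta>) \<le> ln (real (Suc n)) powr (1 - 2 * \<beta>) / (2 * \<beta> - 1)"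
      using n \<beta> by (simp add: powr_mult divide_right_mono)
    also have "\<dots> \<le> tail n" by (rule log_tail_bounds(1)[OF \<beta> k0 \<gamma> elim])
    finally have "sqrt (?B * ln (real n) powr (1 - 2 * \<beta>) / real n) \<le> sqrt (tail n / real n)"
      by (intro real_sqrt_le_mono divide_right_mono) auto
    moreover have "tail n \<le> ?A * ln (real n) powr (1 - 2 * \<beta>)"
      using log_tail_bounds(2)[OF \<beta> k0 \<gamma> elim] by simp
    then have "sqrt (tail n / real n) \<le> sqrt (?A * ln (real n) powr (1 - 2 * \<beta>) / real n)"
      by (intro real_sqrt_le_mono divide_right_mono) auto
    ultimately show ?case unfolding w by simp
  qed
  show "(\<lambda>n. sampling_number n \<gamma>) \<asymp> (\<lambda>n. ennreal (real n powr (-1/2) * ln (real n) powr (-\<beta> + 1/2)))"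
    unfolding w_def[symmetric]
  proof (rule asymp_equal_sandwich(2))
    \<comment> \<open>The lower bound for sampling is inherited from integration.\<close>
    have "\<forall>\<^sub>F n in sequentially. ennreal (sqrt (b\<^sup>2 / 8) * sqrt (tail n / real n)) \<le> sampling_number n \<gamma>"
      using eventually_integration_number_ge
      by eventually_elim (rule order_trans[OF _ integration_number_le_sampling_number])
    then show "\<forall>\<^sub>F n in sequentially. ennreal (sqrt (b\<^sup>2 / 8) * sqrt ?B * w n) \<le> sampling_number n \<gamma>"
      using bounds
    proof eventually_elim
      case (elim n)
      have "sqrt (b\<^sup>2 / 8) * (sqrt ?B * w n) \<le> sqrt (b\<^sup>2 / 8) * sqrt (tail n / real n)"
        using elim(2) by (intro mult_left_mono) auto
      then show ?case using elim(1) by (metis mult.assoc ennreal_leI order_trans)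
    qed
    show "\<forall>\<^sub>F n in sequentially. sampling_number n \<gamma> \<le> ennreal (sqrt (4 / (b\<^sup>2)\<^sup>2) * sqrt ?A * w n)"
      using bounds eventually_ge_at_top[of 1]
    proof eventually_elim
      case (elim n)
      have "sqrt (4 / (b\<^sup>2)\<^sup>2) * sqrt (tail n / real n) \<le> sqrt (4 / (b\<^sup>2)\<^sup>2) * (sqrt ?A * w n)"
        using elim(1) by (intro mult_left_mono) auto
      then show ?case using sampling_number_le[OF elim(2)] by (metis mult.assoc ennreal_leI order_trans)
    qed
    show "0 < sqrt (b\<^sup>2 / 8) * sqrt ?B" "0 < sqrt (4 / (b\<^sup>2)\<^sup>2) * sqrt ?A"
      using b_pos pos by auto
  qed auto
qed

end

theorem theorem4:
  fixes \<gamma> :: "int \<Rightarrow> real" and b :: real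
  assumes "\<And>j. \<gamma> j \<ge> 0"
    and "(\<lambda>j. (\<gamma> j)\<^sup>2) summable_on UNIV"
    and "\<And>k. \<gamma> (- k) = \<gamma> k"
    and "antimono (\<lambda>n::nat. \<gamma> (int n))"
    and "b > 0"
    and "\<And>n::nat. \<gamma> (2 * int n) \<ge> b * \<gamma> (int n)"
  shows "((\<lambda>n. (integration_number n \<gamma>)\<^sup>2) \<asymp> (\<lambda>n. (sampling_number n \<gamma>)\<^sup>2) \<and>
      (\<lambda>n. (sampling_number n \<gamma>)\<^sup>2) \<asymp>
        (\<lambda>n. ennreal (1 / real n * (\<Sum>\<^sub>\<infinity>j\<in>{int n<..}. (\<gamma> j)\<^sup>2)))) \<and>
    (\<forall>(\<beta>::real) (k\<^sub>0::nat).
      \<beta> > 1/2 \<and> k\<^sub>0 \<ge> 2 \<and>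
      (\<forall>k\<ge>k\<^sub>0. \<gamma> (int k) = real k powr (-1/2) * ln (real k) powr (-\<beta>)) \<longrightarrow>
        (\<lambda>n. approx_number n \<gamma>) \<asymp> (\<lambda>n. ennreal (real n powr (-1/2) * ln (real n) powr (-\<beta>))) \<and>
        (\<lambda>n. integration_number n \<gamma>) \<asymp> (\<lambda>n. sampling_number n \<gamma>) \<and>
        (\<lambda>n. sampling_number n \<gamma>) \<asymp>
          (\<lambda>n. ennreal (real n powr (-1/2) * ln (real n) powr (-\<beta> + 1/2))))"
proof -
  interpret doubling_weights \<gamma> b by unfold_locales (fact assms)+
  have "(ennreal (sqrt (tail n / real n)))\<^sup>2 = ennreal (1 / real n * (\<Sum>\<^sub>\<infinity>j\<in>{int n<..}. (\<gamma> j)\<^sup>2))" for n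
    using tail_nonneg[of n] by (simp add: ennreal_power tail_def)
  then have "(\<lambda>n. (sampling_number n \<gamma>)\<^sup>2) \<asymp>
      (\<lambda>n. ennreal (1 / real n * (\<Sum>\<^sub>\<infinity>j\<in>{int n<..}. (\<gamma> j)\<^sup>2)))"
    using asymp_equal_power2[OF asymp_tail(2)] by simp
  then show ?thesis
    using asymp_equal_power2[OF asymp_tail(1)] asymp_tail(1) log_weights_asymp by blast
qed

end
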